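(* Let $k\in\mathbb N$ and $0<j<2k$ be integers with $\gcd(j,k)=1$. If $(a,s)\in\mathcal B_{(j,k)}\setminus\mathcal B_{\mathrm{triv}}$, then $\gamma_{a,s}([-\ell_k(a,s),\ell_k(a,s)])$ is a closed geodesic in $\Omega_a$ that intersects the Clifford geodesic $\gamma_{a,0}$ at $2j$ instants (i.e., there are exactly $2j$ values $t\in[-\ell_k(a,s),\ell_k(a,s)]$ with $\rho_{a,s}(t)=\rho_{a,0}$), has winding number $k$ around $O$, and self-intersects along $D(0)$ at $k-1$ instants (i.e., there are exactly $k-1$ values $t\in(0,\ell_k(a,s))$ with $\gamma_{a,s}(-t)=\gamma_{a,s}(t)\in D(0)$ as points of $\Omega_a$). In particular, bifurcation branches are pairwise disjoint: $\mathcal B_{(j,k)}\cap\mathcal B_{(j',k')}=\emptyset$ if $(j,k)\neq(j',k')$, where also $0<j'<2k'$ and $\gcd(j',k')=1$.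
   Context: For $a>0$, let $\mathbb S^3_a=\{(z,w)\in\mathbb C^2 : |z|^2/a^2+|w|^2=1\}$ with the metric induced from $\mathbb C^2$, on which the circle $\{1\}\times\mathsf S^1$ acts isometrically by unit complex multiplication on $w$. Let $\Omega_a$ be the orbit space $\{(z,r)\in\mathbb C\times\mathbb R: |z|^2/a^2+r^2=1,\ r\ge0\}$ (quotient map $(z,w)\mapsto(z,|w|)$) with the metric $(2\pi r)^2\check{\mathrm g}_a$, where $\check{\mathrm g}_a$ is induced from $\mathbb C\times\mathbb R$. Writing $z=a e^{i\theta}\sin\phi$, $r=\cos\phi$, $\phi\in[0,\frac\pi2]$, and $\rho(\phi)=2\pi\int_0^\phi\cos\xi\sqrt{a^2\cos^2\xi+\sin^2\xi}\,d\xi$, $L_a=\rho(\frac\pi2)$, the metric of $\Omega_a$ in polar coordinates $(\rho,\theta)$ is $d\rho^2+\varphi(\rho)^2d\theta^2$, with $\varphi(\rho)=\pi a\sin(2\phi(\rho))$, where $\phi(\rho)$ is the inverse of $\rho(\phi)$. It is smooth for $0\le\rho<L_a$ and singular at $\rho=L_a$. The central point is $O=\{\rho=0\}$, and $D(0)$ is the diameter of $\Omega_a$ given by the closure of $\{\theta=0\}\cup\{\theta=\pi\}$. Let $\rho_{a,0}\in(0,L_a)$ be the value with $\phi(\rho_{a,0})=\frac\pi4$. Fix functions $\beta_a\colon(-1,1)\to(0,L_a)$, $a>0$, such that $(a,s)\mapsto\beta_a(s)$ is real analytic, $\beta_a$ is bijective, $\beta_a'(s)>0$ and $\beta_a(0)=\rho_{a,0}$.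 For $(a,s)\in(0,+\infty)\times(-1,1)$, let $\gamma_{a,s}(t)=(\rho_{a,s}(t),\theta_{a,s}(t))$ be the maximal geodesic in $\Omega_a$ with $\gamma_{a,s}(0)=(\beta_a(s),0)$ and $\dot\rho_{a,s}(0)=0$, $\dot\theta_{a,s}(0)=1$; here $\theta_{a,s}$ is a continuous real-valued (lifted) angle. It is defined for all $t\in\mathbb R$; the Clifford geodesic is $\gamma_{a,0}(t)=(\rho_{a,0},t)$. For $k\in\mathbb N=\{1,2,\dots\}$, let $\ell_k(a,s)>0$ be the unique number with $\theta_{a,s}(\ell_k(a,s))=k\pi$, and set $f_k(a,s)=\dot\rho_{a,s}(\ell_k(a,s))$, a real analytic function on $(0,+\infty)\times(-1,1)$ vanishing on the trivial branch $\mathcal B_{\mathrm{triv}}=\{(a,0):a>0\}$. For integers $0<j<2k$ with $\gcd(j,k)=1$, put $a^j_k=(j/k)/\sqrt{4-(j/k)^2}$; $\mathcal B_{(j,k)}$ denotes the connected component containing $(a^j_k,0)$ of the closure of $f_k^{-1}(0)\setminus\mathcal B_{\mathrm{triv}}$ in $(0,+\infty)\times(-1,1)$. *)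

theory Defs
  imports "HOL-Complex_Analysis.Complex_Analysis"
begin

definition real_analytic2_on :: "(real \<times> real \<Rightarrow> real) \<Rightarrow> (real \<times> real) set \<Rightarrow> bool" where
  "real_analytic2_on f S \<longleftrightarrow>
     (\<forall>(x, y) \<in> S. \<exists>r>0. \<exists>c :: nat \<times> nat \<Rightarrow> real. \<forall>u v. \<bar>u\<bar> < r \<and> \<bar>v\<bar> < r \<longrightarrow>
        ((\<lambda>(m, n). c (m, n) * u ^ m * v ^ n) has_sum f (x + u, y + v)) UNIV)"


definition Omega :: "real \<Rightarrow> (complex \<times> real) set" where
  "Omega a = {(z, r). (cmod z)\<^sup>2 / a\<^sup>2 + r\<^sup>2 = 1 \<and> r \<ge> 0}"

definition rho_of :: "real \<Rightarrow> real \<Rightarrow> real" where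
  "rho_of a p = 2 * pi * integral {0..p} (\<lambda>x. cos x * sqrt (a\<^sup>2 * (cos x)\<^sup>2 + (sin x)\<^sup>2))"

definition L :: "real \<Rightarrow> real" where
  "L a = rho_of a (pi / 2)"

definition phi_of :: "real \<Rightarrow> real \<Rightarrow> real" where
  "phi_of a = the_inv_into {0..pi / 2} (rho_of a)"

text \<open>The function \<open>\<varphi>\<close> in the metric \<open>d\<rho>\<^sup>2 + \<varphi>(\<rho>)\<^sup>2 d\<theta>\<^sup>2\<close>.\<close>

definition warp :: "real \<Rightarrow> real \<Rightarrow> real" where
  "warp a x = pi * a * sin (2 * phi_of a x)"

definition rho0 :: "real \<Rightarrow> real" where
  "rho0 a = rho_of a (pi / 4)"

text \<open>The point of \<open>\<Omega>\<^sub>a\<close> with polar coordinates \<open>(\<rho>, \<theta>) = (x, y)\<close>.\<close>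

definition pt :: "real \<Rightarrow> real \<Rightarrow> real \<Rightarrow> complex \<times> real" where
  "pt a x y = (of_real a * cis y * of_real (sin (phi_of a x)), cos (phi_of a x))"

definition diam0 :: "real \<Rightarrow> (complex \<times> real) set" where
  "diam0 a = closure {pt a x y | x y. 0 < x \<and> x < L a \<and> (y = 0 \<or> y = pi)}"


text \<open>
  Geodesics in the polar chart \<open>0 < \<rho> < L a\<close>, parametrised by the whole real line and hence
  maximal; \<open>\<theta>\<close> is the lifted angle.  The nonzero Christoffel symbols of
  \<open>d\<rho>\<^sup>2 + \<varphi>(\<rho>)\<^sup>2 d\<theta>\<^sup>2\<close> are \<open>\<Gamma>\<^sup>\<rho>\<^sub>\<theta>\<^sub>\<theta> = - \<varphi> \<varphi>'\<close> and
  \<open>\<Gamma>\<^sup>\<theta>\<^sub>\<rho>\<^sub>\<theta> = \<Gamma>\<^sup>\<theta>\<^sub>\<theta>\<^sub>\<rho> = \<varphi>' / \<varphi>\<close>.  By Clairaut's relation, a geodesic with nonzero angular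
  velocity at some instant never reaches \<open>\<rho> = 0\<close> or \<open>\<rho> = L a\<close>, so it stays in this chart.
\<close>

definition polar_geodesic :: "real \<Rightarrow> (real \<Rightarrow> real) \<Rightarrow> (real \<Rightarrow> real) \<Rightarrow> bool" where
  "polar_geodesic a \<rho> \<theta> \<longleftrightarrow>
     (\<forall>t. 0 < \<rho> t \<and> \<rho> t < L a \<and>
          \<rho> differentiable (at t) \<and> \<theta> differentiable (at t) \<and>
          (deriv \<rho> has_real_derivative
             warp a (\<rho> t) * deriv (warp a) (\<rho> t) * (deriv \<theta> t)\<^sup>2) (at t) \<and>
          (deriv \<theta> has_real_derivative
             - 2 * (deriv (warp a) (\<rho> t) / warp a (\<rho> t)) * deriv \<rho> t * deriv \<theta> t) (at t))"

definition curve :: "real \<Rightarrow> (real \<Rightarrow> real) \<Rightarrow> (real \<Rightarrow> real) \<Rightarrow> real \<Rightarrow> complex \<times> real" where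
  "curve a \<rho> \<theta> t = pt a (\<rho> t) (\<theta> t)"

definition closed_geodesic_on ::
  "real \<Rightarrow> (real \<Rightarrow> real) \<Rightarrow> (real \<Rightarrow> real) \<Rightarrow> real \<Rightarrow> real \<Rightarrow> bool" where
  "closed_geodesic_on a \<rho> \<theta> u v \<longleftrightarrow>
     u < v \<and> polar_geodesic a \<rho> \<theta> \<and> curve a \<rho> \<theta> ` {u..v} \<subseteq> Omega a \<and>
     curve a \<rho> \<theta> u = curve a \<rho> \<theta> v \<and>
     (\<exists>w. w \<noteq> 0 \<and> (curve a \<rho> \<theta> has_vector_derivative w) (at u) \<and>
          (curve a \<rho> \<theta> has_vector_derivative w) (at v))"

text \<open>
  The projection \<open>(z, r) \<mapsto> z\<close> is a homeomorphism of \<open>\<Omega>\<^sub>a\<close> onto the closed disc of radius \<open>a\<close>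
  that sends the central point \<open>O = (0, 1)\<close> to \<open>0\<close>.
\<close>

definition winding_about_O :: "(real \<Rightarrow> complex \<times> real) \<Rightarrow> real \<Rightarrow> real \<Rightarrow> complex" where
  "winding_about_O c u v = winding_number (fst \<circ> c \<circ> linepath u v) 0"


definition param_domain :: "(real \<times> real) set" where
  "param_domain = {0<..} \<times> {-1<..<1}"

definition admissible_beta :: "(real \<Rightarrow> real \<Rightarrow> real) \<Rightarrow> bool" where
  "admissible_beta \<beta> \<longleftrightarrow>
     real_analytic2_on (\<lambda>(a, s). \<beta> a s) param_domain \<and>
     (\<forall>a>0. bij_betw (\<beta> a) {-1<..<1} {0<..<L a} \<and>
            (\<forall>s\<in>{-1<..<1}. deriv (\<beta> a) s > 0) \<and>
            \<beta> a 0 = rho0 a)"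

definition geodesic_family ::
  "(real \<Rightarrow> real \<Rightarrow> real) \<Rightarrow> (real \<Rightarrow> real \<Rightarrow> real \<Rightarrow> real) \<Rightarrow> (real \<Rightarrow> real \<Rightarrow> real \<Rightarrow> real) \<Rightarrow> bool" where
  "geodesic_family \<beta> \<rho> \<theta> \<longleftrightarrow>
     (\<forall>(a, s) \<in> param_domain.
        polar_geodesic a (\<rho> a s) (\<theta> a s) \<and>
        \<rho> a s 0 = \<beta> a s \<and> \<theta> a s 0 = 0 \<and>
        deriv (\<rho> a s) 0 = 0 \<and> deriv (\<theta> a s) 0 = 1)"

definition ell :: "(real \<Rightarrow> real \<Rightarrow> real \<Rightarrow> real) \<Rightarrow> nat \<Rightarrow> real \<Rightarrow> real \<Rightarrow> real" where
  "ell \<theta> k a s = (THE l. 0 < l \<and> \<theta> a s l = real k * pi)"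

definition bif_fun ::
  "(real \<Rightarrow> real \<Rightarrow> real \<Rightarrow> real) \<Rightarrow> (real \<Rightarrow> real \<Rightarrow> real \<Rightarrow> real) \<Rightarrow> nat \<Rightarrow> real \<Rightarrow> real \<Rightarrow> real" where
  "bif_fun \<rho> \<theta> k a s = deriv (\<rho> a s) (ell \<theta> k a s)"

definition triv_branch :: "(real \<times> real) set" where
  "triv_branch = {0<..} \<times> {0}"

definition a_bif :: "nat \<Rightarrow> nat \<Rightarrow> real" where
  "a_bif j k = (real j / real k) / sqrt (4 - (real j / real k)\<^sup>2)"

definition branch ::
  "(real \<Rightarrow> real \<Rightarrow> real \<Rightarrow> real) \<Rightarrow> (real \<Rightarrow> real \<Rightarrow> real \<Rightarrow> real) \<Rightarrow> nat \<Rightarrow> nat \<Rightarrow> (real \<times> real) set" where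
  "branch \<rho> \<theta> j k =
     connected_component_set
       (param_domain \<inter>
          closure ({(a, s) \<in> param_domain. bif_fun \<rho> \<theta> k a s = 0} - triv_branch))
       (a_bif j k, 0)"

end

theory Submission imports Defs begin

text \<open>
  With \<open>p\<close> the angle \<open>\<phi>(\<rho>(t))\<close> along the geodesic, put \<open>x = cos (2 p)\<close>.
  Clairaut's relation and conservation of energy turn the geodesic equations into
  \<open>x'\<^sup>2 = \<sigma>(x)\<^sup>2 (x(0)\<^sup>2 - x\<^sup>2)\<close> with \<open>\<sigma> > 0\<close>, so \<open>x = x(0) cos \<psi>\<close> for a phase \<open>\<psi>\<close> with \<open>\<psi>' = \<sigma>(x)\<close>,
  and \<open>\<theta>\<close> is a function of \<open>\<psi>\<close> that increases by the same amount \<open>H(a, x(0))\<close> on every interval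
  \<open>[m \<pi>, (m + 1) \<pi>]\<close>.  Off the trivial branch, \<open>f\<^sub>k(a, s) = 0\<close> says that the phase at \<open>\<ell>\<^sub>k\<close> is a multiple
  \<open>m \<pi>\<close>, that is, \<open>k \<pi> / H = m\<close> is an integer.  Since \<open>H\<close> is continuous in \<open>(a, s)\<close>, including at
  \<open>s = 0\<close>, this integer is constant on \<open>\<B>\<^sub>(\<^sub>j\<^sub>,\<^sub>k\<^sub>)\<close>, and at \<open>(a\<^sup>j\<^sub>k, 0)\<close> it equals \<open>j\<close>.  Everything is then
  read off from \<open>\<psi>(\<ell>\<^sub>k) = j \<pi>\<close> and \<open>\<theta>(\<ell>\<^sub>k) = k \<pi>\<close>, and the ratio \<open>j / k\<close> separates the branches.
\<close>

section \<open>The polar radius and its inverse\<close>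

text \<open>With x = cos (2 p) one has cos^2 p = (1 + x) / 2 and sin^2 p = (1 - x) / 2, so this is
  the integrand of \<open>rho_of\<close> at p, rewritten as a function of x.\<close>

definition slope :: "real \<Rightarrow> real \<Rightarrow> real" where
  "slope a x = sqrt ((1 + x) / 2 * ((a\<^sup>2 * (1 + x) + (1 - x)) / 2))"

lemma slope_cos_double:
  assumes "0 \<le> p" "p \<le> pi / 2"
  shows "slope a (cos (2 * p)) = cos p * sqrt (a\<^sup>2 * (cos p)\<^sup>2 + (sin p)\<^sup>2)"
proof -
  have c: "cos p \<ge> 0" using assms by (intro cos_ge_zero) auto
  have 1: "1 + cos (2 * p) = 2 * (cos p)\<^sup>2" "1 - cos (2 * p) = 2 * (sin p)\<^sup>2"
    by (simp_all add: cos_double_cos cos_double_sin)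
       (simp add: sin_squared_eq)
  have "(1 + cos (2 * p)) / 2 * ((a\<^sup>2 * (1 + cos (2 * p)) + (1 - cos (2 * p))) / 2)
      = (cos p)\<^sup>2 * (a\<^sup>2 * (cos p)\<^sup>2 + (sin p)\<^sup>2)"
    unfolding 1 by (simp add: field_simps)
  then show ?thesis
    unfolding slope_def using c by (simp add: real_sqrt_mult)
qed

lemma slope_pos:
  assumes "a > 0" "-1 < x" "x < 1"
  shows "slope a x > 0"
proof -
  have "a\<^sup>2 * (1 + x) > 0" using assms by simp
  then have "a\<^sup>2 * (1 + x) + (1 - x) > 0" using assms by (intro add_pos_pos) auto
  then show ?thesis using assms by (auto simp: slope_def)
qed

lemma slope_le:
  assumes "a > 0" "-1 < x" "x < 1"
  shows "slope a x \<le> sqrt (a\<^sup>2 + 1)"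
proof -
  have "(1 + x) / 2 * ((a\<^sup>2 * (1 + x) + (1 - x)) / 2) \<le> 1 * (a\<^sup>2 + 1)"
  proof (rule mult_mono)
    have "(a\<^sup>2 * (1 + x) + (1 - x)) / 2 \<le> (a\<^sup>2 * 2 + 2) / 2"
      using assms by (intro divide_right_mono add_mono mult_left_mono) auto
    then show "(a\<^sup>2 * (1 + x) + (1 - x)) / 2 \<le> a\<^sup>2 + 1" by simp
  qed (use assms in auto)
  then show ?thesis unfolding slope_def by simp
qed

lemma continuous_slope [continuous_intros]:
  assumes "continuous_on S f" "continuous_on S g"
  shows "continuous_on S (\<lambda>z. slope (f z) (g z))"
  unfolding slope_def using assms by (intro continuous_intros) auto

text \<open>The integrand of \<open>rho_of\<close>. It vanishes at p = pi / 2, where the metric is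
  singular, so the inverse function is differentiated only for p < pi / 2.\<close>

abbreviation speed :: "real \<Rightarrow> real \<Rightarrow> real" where
  "speed a p \<equiv> cos p * sqrt (a\<^sup>2 * (cos p)\<^sup>2 + (sin p)\<^sup>2)"

lemma speed_pos:
  assumes "a > 0" "0 \<le> p" "p < pi / 2"
  shows "speed a p > 0"
proof -
  have c: "cos p > 0" using assms by (intro cos_gt_zero_pi) auto
  then have "a\<^sup>2 * (cos p)\<^sup>2 > 0" using assms by simp
  then have "a\<^sup>2 * (cos p)\<^sup>2 + (sin p)\<^sup>2 > 0" by (smt (verit) zero_le_power2)
  then show ?thesis using c by simp
qed

lemma DERIV_rho_of:
  assumes "0 \<le> p" "p \<le> pi / 2"
  shows "(rho_of a has_real_derivative 2 * pi * speed a p) (at p within {0..pi / 2})"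
proof -
  have "((\<lambda>u. integral {0..u} (speed a)) has_real_derivative speed a p) (at p within {0..pi / 2})"
    using assms by (intro integral_has_real_derivative continuous_intros) auto
  then show ?thesis
    unfolding rho_of_def[abs_def] by (auto intro: DERIV_cmult)
qed

lemma DERIV_rho_of_interior:
  assumes "0 < p" "p < pi / 2"
  shows "(rho_of a has_real_derivative 2 * pi * speed a p) (at p)"
  using DERIV_rho_of[of p a] assms at_within_Icc_at[of 0 p "pi/2"] by simp

lemma continuous_on_rho_of: "continuous_on {0..pi / 2} (rho_of a)"
  by (meson DERIV_rho_of DERIV_continuous atLeastAtMost_iff continuous_on_eq_continuous_within)

lemma rho_of_strict_mono:
  assumes "a > 0" "0 \<le> p" "p < q" "q \<le> pi / 2"
  shows "rho_of a p < rho_of a q"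
proof (rule DERIV_pos_imp_increasing_open[OF \<open>p < q\<close>])
  show "\<exists>y. (rho_of a has_real_derivative y) (at x) \<and> 0 < y" if "p < x" "x < q" for x
    using DERIV_rho_of_interior[of x a] speed_pos[of a x] that assms
    by (intro exI[of _ "2 * pi * speed a x"]) auto
  show "continuous_on {p..q} (rho_of a)"
    using assms by (intro continuous_on_subset[OF continuous_on_rho_of]) auto
qed

lemma rho_of_0 [simp]: "rho_of a 0 = 0"
  by (simp add: rho_of_def)

lemma inj_on_rho_of: "a > 0 \<Longrightarrow> inj_on (rho_of a) {0..pi / 2}"
  by (intro linorder_inj_onI') (metis atLeastAtMost_iff less_irrefl rho_of_strict_mono)

lemma phi_of_rho_of:
  assumes "a > 0" "0 \<le> p" "p \<le> pi / 2"
  shows "phi_of a (rho_of a p) = p"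
  unfolding phi_of_def using the_inv_into_f_f[OF inj_on_rho_of] assms by simp

lemma rho_of_phi_of:
  assumes "a > 0" "0 < r" "r < L a"
  shows "rho_of a (phi_of a r) = r" "0 < phi_of a r" "phi_of a r < pi / 2"
proof -
  obtain p where p: "0 \<le> p" "p \<le> pi / 2" "rho_of a p = r"
    using IVT'[of "rho_of a" 0 r "pi / 2"] assms continuous_on_rho_of by (auto simp: L_def)
  moreover have "p \<noteq> 0" "p \<noteq> pi / 2" using p assms(2,3) unfolding L_def by fastforce+
  ultimately show "rho_of a (phi_of a r) = r" "0 < phi_of a r" "phi_of a r < pi / 2"
    using phi_of_rho_of[of a p] assms by auto
qed

text \<open>The integrand is jointly continuous in a and the variable of integration. Combined with
  monotonicity in p, this gives joint continuity of the inverse.\<close>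

lemma continuous_on_rho_of_param:
  assumes "0 \<le> p" "p \<le> pi / 2"
  shows "continuous_on UNIV (\<lambda>a. rho_of a p)"
  unfolding rho_of_def interval_cbox
  by (intro continuous_intros integral_continuous_on_param) 
     (auto simp: case_prod_beta intro!: continuous_intros)

text \<open>For q on either side of \<open>phi_of a r\<close>, strict monotonicity separates
  \<open>rho_of a q\<close> from r. With q fixed, this inequality persists for nearby parameters,
  and monotonicity of \<open>rho_of (f z)\<close> turns it into a bound on
  \<open>phi_of (f z) (g z)\<close>.\<close>

lemma tendsto_phi_of:
  assumes a: "a > 0" and r: "0 < r" "r < L a"
    and f: "(f \<longlongrightarrow> a) F" and g: "(g \<longlongrightarrow> r) F"
  shows "((\<lambda>z. phi_of (f z) (g z)) \<longlongrightarrow> phi_of a r) F"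
proof (rule order_tendstoI)
  note p = rho_of_phi_of[OF a r]
  have fp: "\<forall>\<^sub>F z in F. f z > 0" using order_tendstoD(1)[OF f a] .
  have gp: "\<forall>\<^sub>F z in F. g z > 0" using order_tendstoD(1)[OF g r(1)] .
  have lim: "((\<lambda>z. rho_of (f z) q) \<longlongrightarrow> rho_of a q) F" if "0 \<le> q" "q \<le> pi / 2" for q
    using continuous_on_tendsto_compose[OF continuous_on_rho_of_param[OF that] f] by simp
  have gL: "\<forall>\<^sub>F z in F. g z < L (f z)"
  proof -
    have "((\<lambda>z. L (f z) - g z) \<longlongrightarrow> L a - r) F"
      unfolding L_def by (intro tendsto_diff lim g) auto
    from order_tendstoD(1)[OF this, of 0] show ?thesis using r by simp
  qed
  have lo: "\<forall>\<^sub>F z in F. rho_of (f z) q < g z" if "0 \<le> q" "q < phi_of a r" for q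
  proof -
    have "rho_of a q < r" using rho_of_strict_mono[OF a, of q "phi_of a r"] that p by simp
    have "((\<lambda>z. g z - rho_of (f z) q) \<longlongrightarrow> r - rho_of a q) F"
      using that p by (intro tendsto_diff lim g) auto
    from order_tendstoD(1)[OF this, of 0] show ?thesis using \<open>rho_of a q < r\<close> by simp
  qed
  have hi: "\<forall>\<^sub>F z in F. g z < rho_of (f z) q" if "phi_of a r < q" "q \<le> pi / 2" for q
  proof -
    have "r < rho_of a q" using rho_of_strict_mono[OF a, of "phi_of a r" q] that p by simp
    have "((\<lambda>z. rho_of (f z) q - g z) \<longlongrightarrow> rho_of a q - r) F"
      using that p by (intro tendsto_diff lim g) auto
    from order_tendstoD(1)[OF this, of 0] show ?thesis using \<open>r < rho_of a q\<close> by simp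
  qed
  show "\<forall>\<^sub>F z in F. q < phi_of (f z) (g z)" if "q < phi_of a r" for q
  proof -
    \<comment> \<open>q may be negative, outside the interval where \<open>rho_of\<close> is
      monotone; as \<open>phi_of a r\<close> is positive, the maximum of 0 and q serves
      instead.\<close>
    have "\<forall>\<^sub>F z in F. rho_of (f z) (max 0 q) < g z" using lo[of "max 0 q"] that p by auto
    then show ?thesis using fp gp gL
    proof eventually_elim
      case (elim z)
      note P = rho_of_phi_of[OF elim(2-4)]
      have "\<not> phi_of (f z) (g z) \<le> max 0 q"
      proof
        assume *: "phi_of (f z) (g z) \<le> max 0 q"
        have "rho_of (f z) (phi_of (f z) (g z)) \<le> rho_of (f z) (max 0 q)"
          using rho_of_strict_mono[OF elim(2), of "phi_of (f z) (g z)" "max 0 q"] P * that p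
          by (cases "phi_of (f z) (g z) = max 0 q") (auto simp: max_def split: if_splits)
        then show False using elim P by simp
      qed
      then show ?case by simp
    qed
  qed
  show "\<forall>\<^sub>F z in F. phi_of (f z) (g z) < q" if "phi_of a r < q" for q
  proof -
    have "\<forall>\<^sub>F z in F. g z < rho_of (f z) (min (pi / 2) q)" using hi[of "min (pi / 2) q"] that p by auto
    then show ?thesis using fp gp gL
    proof eventually_elim
      case (elim z)
      note P = rho_of_phi_of[OF elim(2-4)]
      have "\<not> min (pi / 2) q \<le> phi_of (f z) (g z)"
      proof
        assume *: "min (pi / 2) q \<le> phi_of (f z) (g z)"
        have "rho_of (f z) (min (pi / 2) q) \<le> rho_of (f z) (phi_of (f z) (g z))"
          using rho_of_strict_mono[OF elim(2), of "min (pi / 2) q" "phi_of (f z) (g z)"] P * that p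
          by (cases "phi_of (f z) (g z) = min (pi / 2) q") (auto simp: min_def split: if_splits)
        then show False using elim P by simp
      qed
      then show ?case by simp
    qed
  qed
qed

lemma DERIV_phi_of:
  assumes "a > 0" "0 < r" "r < L a"
  shows "(phi_of a has_real_derivative inverse (2 * pi * speed a (phi_of a r))) (at r)"
proof (rule DERIV_inverse_function[where f = "rho_of a" and a = 0 and b = "L a"])
  note p = rho_of_phi_of[OF assms]
  show "(rho_of a has_real_derivative 2 * pi * speed a (phi_of a r)) (at (phi_of a r))"
    using p by (intro DERIV_rho_of_interior)
  show "2 * pi * speed a (phi_of a r) \<noteq> 0" using speed_pos[of a "phi_of a r"] p assms(1) by auto
  show "isCont (phi_of a) r" unfolding isCont_def
    using assms by (intro tendsto_phi_of[where f = "\<lambda>_. a"] tendsto_intros)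
qed (use assms rho_of_phi_of in auto)

lemma DERIV_warp:
  assumes "a > 0" "0 < r" "r < L a"
  shows "(warp a has_real_derivative a * cos (2 * phi_of a r) / speed a (phi_of a r)) (at r)"
proof -
  have nz: "speed a (phi_of a r) \<noteq> 0"
    using speed_pos[of a "phi_of a r"] rho_of_phi_of[OF assms] assms(1) by auto
  have "(warp a has_real_derivative
      pi * a * (cos (2 * phi_of a r) * (2 * inverse (2 * pi * speed a (phi_of a r))))) (at r)"
    unfolding warp_def[abs_def]
    by (intro DERIV_cmult DERIV_chain2[OF DERIV_sin] DERIV_phi_of assms)
  also have "pi * a * (cos (2 * phi_of a r) * (2 * inverse (2 * pi * speed a (phi_of a r))))
     = a * cos (2 * phi_of a r) / speed a (phi_of a r)"
    using nz by (simp add: field_simps)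
  finally show ?thesis .
qed

section \<open>Continuity of real analytic functions\<close>

text \<open>The series converges absolutely at (R, R) for R < r. Every nonconstant term at (u, v) is
  dominated by a small multiple of the corresponding term there, so the increment of f is bounded by
  that multiple of the absolute sum K.\<close>

lemma real_analytic2_isCont:
  assumes "real_analytic2_on f S" "z \<in> S"
  shows "isCont f z"
proof -
  obtain x y where z: "z = (x, y)" by fastforce
  obtain r c where r: "r > 0" and
    c: "\<And>u v. \<bar>u\<bar> < r \<Longrightarrow> \<bar>v\<bar> < r \<Longrightarrow>
        ((\<lambda>(m, n). c (m, n) * u ^ m * v ^ n) has_sum f (x + u, y + v)) (UNIV :: (nat \<times> nat) set)"
    using assms unfolding real_analytic2_on_def z by fastforce
  define R where "R = r / 2"
  have R: "R > 0" "R < r" using r by (auto simp: R_def)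
  define K where "K = (\<Sum>\<^sub>\<infinity>z. \<bar>case z of (m, n) \<Rightarrow> c (m, n) * R ^ m * R ^ n\<bar>)"
  have "(\<lambda>(m, n). c (m, n) * R ^ m * R ^ n) summable_on UNIV"
    using c[of R R] R by (auto simp: summable_on_def)
  then have sumK: "(\<lambda>z. \<bar>case z of (m, n) \<Rightarrow> c (m, n) * R ^ m * R ^ n\<bar>) summable_on UNIV"
    using summable_on_iff_abs_summable_on_real by fastforce
  have f0: "f (x, y) = c (0, 0)"
  proof -
    have "((\<lambda>(m, n). c (m, n) * 0 ^ m * 0 ^ n) has_sum f (x, y)) UNIV"
      using c[of 0 0] r by simp
    moreover have "((\<lambda>(m, n). c (m, n) * 0 ^ m * 0 ^ n) has_sum c (0, 0)) UNIV"
      by (rule has_sum_finite_neutralI[where B = "{(0, 0)}"]) (auto simp: power_0_left split: if_splits)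
    ultimately show ?thesis using has_sum_unique by blast
  qed
  have bound: "\<bar>f (x + u, y + v) - f (x, y)\<bar> \<le> max \<bar>u\<bar> \<bar>v\<bar> / R * K"
    if uv: "\<bar>u\<bar> < R" "\<bar>v\<bar> < R" for u v
  proof -
    \<comment> \<open>With d the size of (u, v) relative to (R, R), a term of total degree m + n is
      at most d^(m + n) times its value at (R, R) in modulus; d \<le> 1 reduces this to one factor d
      once the degree is positive.\<close>
    define d where "d = max \<bar>u\<bar> \<bar>v\<bar> / R"
    have d: "0 \<le> d" "d \<le> 1" "\<bar>u\<bar> \<le> d * R" "\<bar>v\<bar> \<le> d * R"
      using uv R by (auto simp: d_def)
    let ?g = "\<lambda>z. (case z of (m, n) \<Rightarrow> c (m, n) * u ^ m * v ^ n)"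
    have hs: "(?g has_sum f (x + u, y + v)) UNIV"
      using c[of u v] uv R by simp
    have "((\<lambda>z. if z = (0, 0) then - c (0, 0) else 0) has_sum - c (0, 0)) (UNIV :: (nat \<times> nat) set)"
      by (rule has_sum_finite_neutralI[where B = "{(0, 0)}"]) (auto split: if_splits)
    from has_sum_add[OF hs this]
    have D: "((\<lambda>z. ?g z + (if z = (0, 0) then - c (0, 0) else 0)) has_sum (f (x + u, y + v) - c (0, 0))) UNIV"
      by simp
    have M: "((\<lambda>z. d * \<bar>case z of (m, n) \<Rightarrow> c (m, n) * R ^ m * R ^ n\<bar>) has_sum d * K) UNIV"
      unfolding K_def by (intro has_sum_cmult_right has_sum_infsum sumK)
    have le: "\<bar>?g z + (if z = (0, 0) then - c (0, 0) else 0)\<bar>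
        \<le> d * \<bar>case z of (m, n) \<Rightarrow> c (m, n) * R ^ m * R ^ n\<bar>" for z
    proof (cases "z = (0, 0)")
      case False
      obtain m n where mn: "z = (m, n)" by fastforce
      obtain N where N: "m + n = Suc N" using False unfolding mn by (cases "m + n") auto
      have "\<bar>u\<bar> ^ m * \<bar>v\<bar> ^ n \<le> (d * R) ^ m * (d * R) ^ n"
        using d R by (intro mult_mono power_mono) auto
      also have "\<dots> = d ^ (m + n) * (R ^ m * R ^ n)"
        by (simp add: power_mult_distrib power_add)
      also have "\<dots> = d * d ^ N * (R ^ m * R ^ n)"
        by (simp add: N)
      also have "\<dots> \<le> d * 1 * (R ^ m * R ^ n)"
        using d R by (intro mult_right_mono mult_left_mono power_le_one) auto
      finally have "\<bar>c (m, n)\<bar> * (\<bar>u\<bar> ^ m * \<bar>v\<bar> ^ n) \<le> \<bar>c (m, n)\<bar> * (d * (R ^ m * R ^ n))"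
        by (intro mult_left_mono) auto
      then show ?thesis using False R unfolding mn
        by (auto simp: abs_mult power_abs algebra_simps)
    qed (use d in simp)
    have "f (x + u, y + v) - c (0, 0) \<le> d * K"
      by (rule has_sum_mono[OF D M]) (use le abs_le_D1 in blast)
    moreover have "- (d * K) \<le> f (x + u, y + v) - c (0, 0)"
    proof (rule has_sum_mono[OF _ D])
      show "((\<lambda>z. - (d * \<bar>case z of (m, n) \<Rightarrow> c (m, n) * R ^ m * R ^ n\<bar>)) has_sum - (d * K)) UNIV"
        using M by (simp add: has_sum_uminus)
      show "- (d * \<bar>case z of (m, n) \<Rightarrow> c (m, n) * R ^ m * R ^ n\<bar>)
          \<le> ?g z + (if z = (0, 0) then - c (0, 0) else 0)" for z
        using le[of z] by linarith
    qed
    ultimately have "\<bar>f (x + u, y + v) - c (0, 0)\<bar> \<le> d * K" by linarith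
    then show ?thesis unfolding f0 d_def by simp
  qed
  have "((\<lambda>w. f w - f z) \<longlongrightarrow> 0) (at z)"
  proof (rule tendsto_0_le[where K = 1])
    show "((\<lambda>w. max \<bar>fst w - x\<bar> \<bar>snd w - y\<bar> / R * K) \<longlongrightarrow> 0) (at z)"
      unfolding z using R by (auto intro!: tendsto_eq_intros)
    have "\<forall>\<^sub>F w in at z. \<bar>fst w - x\<bar> < R" "\<forall>\<^sub>F w in at z. \<bar>snd w - y\<bar> < R"
      unfolding z using R
      by (auto intro!: order_tendstoD(2)[where y = 0] tendsto_eq_intros)
    then show "\<forall>\<^sub>F w in at z. norm (f w - f z) \<le> norm (max \<bar>fst w - x\<bar> \<bar>snd w - y\<bar> / R * K) * 1"
    proof eventually_elim
      case (elim w)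
      have "f w = f (x + (fst w - x), y + (snd w - y))" by simp
      then have "norm (f w - f z) \<le> max \<bar>fst w - x\<bar> \<bar>snd w - y\<bar> / R * K"
        using bound[OF elim] unfolding z real_norm_def by metis
      then show ?case unfolding real_norm_def mult_1_right by linarith
    qed
  qed
  then show ?thesis unfolding isCont_def using LIM_zero_cancel by blast
qed

section \<open>Primitives\<close>

text \<open>The interval integral is signed, so this is an antiderivative on the whole line;
  \<open>integral {0..x} f\<close> would be 0 for negative x.\<close>

definition primitive :: "(real \<Rightarrow> real) \<Rightarrow> real \<Rightarrow> real" where
  "primitive f x = (LBINT y=0..x. f y)"

lemma primitive_0 [simp]: "primitive f 0 = 0"
  by (simp add: primitive_def zero_ereal_def)

lemma DERIV_primitive:
  assumes "continuous_on UNIV f"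
  shows "(primitive f has_real_derivative f x) (at x)"
proof -
  have "((\<lambda>u. LBINT y=ereal 0..u. f y) has_vector_derivative f x) (at x within {-\<bar>x\<bar> - 1..\<bar>x\<bar> + 1})"
    using continuous_on_subset[OF assms] by (intro interval_integral_FTC2) auto
  moreover have "at x within {-\<bar>x\<bar> - 1..\<bar>x\<bar> + 1} = at x"
    by (rule at_within_Icc_at) auto
  ultimately show ?thesis
    unfolding primitive_def[abs_def] zero_ereal_def
    by (simp add: has_real_derivative_iff_has_vector_derivative)
qed

text \<open>The difference has derivative zero. This identifies primitives with their reflections
  and shifts, and later expresses angle and time through the phase.\<close>

lemma primitive_unique:
  assumes "\<And>t. (F has_real_derivative F' t) (at t)" "\<And>t. (G has_real_derivative F' t) (at t)"
    and "F 0 = G (0::real)"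
  shows "F t = G t"
proof -
  have "\<forall>t. ((\<lambda>t. F t - G t) has_real_derivative 0) (at t)"
    using DERIV_diff[OF assms(1,2)] by simp
  from DERIV_isconst_all[OF this, of t 0] show ?thesis using assms(3) by simp
qed

lemma primitive_eq_integral:
  assumes "continuous_on UNIV f" "0 \<le> x"
  shows "primitive f x = integral {0..x} f"
proof -
  have "(f has_integral primitive f x - primitive f 0) {0..x}"
    using assms DERIV_primitive[OF assms(1)]
    by (intro fundamental_theorem_of_calculus)
       (auto simp: has_real_derivative_iff_has_vector_derivative intro: has_vector_derivative_at_within)
  then show ?thesis by (simp add: integral_unique)
qed

lemma strict_mono_primitive:
  assumes "continuous_on UNIV f" "\<And>x. f x > 0"
  shows "strict_mono (primitive f)"
proof (rule strict_monoI)
  fix u w :: real assume "u < w"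
  moreover have "\<exists>y. (primitive f has_real_derivative y) (at x) \<and> 0 < y" for x
    using DERIV_primitive[OF assms(1), of x] assms(2)[of x] by (intro exI[of _ "f x"] conjI)
  ultimately show "primitive f u < primitive f w"
    by (rule DERIV_pos_imp_increasing)
qed

lemma primitive_odd:
  assumes "continuous_on UNIV f" "\<And>x. f (- x) = f x"
  shows "primitive f (- x) = - primitive f x"
proof -
  have "((\<lambda>x. - primitive f (- x)) has_real_derivative f x) (at x)" for x
    using DERIV_chain2[OF DERIV_primitive[OF assms(1)] DERIV_minus[OF DERIV_ident], of x, THEN DERIV_minus]
      assms(2) by simp
  from primitive_unique[OF this DERIV_primitive[OF assms(1)], of x] show ?thesis by simp
qed

lemma primitive_periodic:
  assumes "continuous_on UNIV f" "\<And>x. f (x + P) = f x"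
  shows "primitive f (x + P) = primitive f x + primitive f P"
proof -
  have "((\<lambda>x. primitive f (x + P) - primitive f P) has_real_derivative f x) (at x)" for x
    using DERIV_primitive[OF assms(1), of "x + P"] assms(2)
    by (auto intro!: derivative_eq_intros simp: DERIV_shift)
  from primitive_unique[OF this DERIV_primitive[OF assms(1)], of x] show ?thesis by simp
qed

text \<open>Periodicity shifts by full periods; evenness splits a full period into two equal halves.\<close>

lemma primitive_multiple_half_period:
  assumes f: "continuous_on UNIV f" "\<And>x. f (- x) = f x" "\<And>x. f (x + 2 * P) = f x"
  shows "primitive f (real m * P) = real m * primitive f P"
proof (induction m rule: induct_nat_012)
  case (ge2 n)
  have "primitive f (- P + 2 * P) = primitive f (- P) + primitive f (2 * P)"
    by (rule primitive_periodic[OF f(1,3)])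
  then have "primitive f (2 * P) = 2 * primitive f P"
    using primitive_odd[OF f(1,2), of P] by simp
  moreover have "primitive f (real n * P + 2 * P) = primitive f (real n * P) + primitive f (2 * P)"
    by (rule primitive_periodic[OF f(1,3)])
  moreover have "real (Suc (Suc n)) * P = real n * P + 2 * P" by (simp add: algebra_simps)
  ultimately show ?case using ge2 by (simp add: algebra_simps)
qed auto

text \<open>f x - m x is nondecreasing, so f grows at least linearly in both directions.\<close>

lemma DERIV_ge_imp_bij:
  fixes f :: "real \<Rightarrow> real"
  assumes der: "\<And>x. (f has_real_derivative f' x) (at x)" and m: "0 < m" "\<And>x. m \<le> f' x"
  shows "strict_mono f" "surj f"
proof -
  have inc: "m * (y - x) \<le> f y - f x" if "x \<le> y" for x y
  proof -
    have "f x - m * x \<le> f y - m * y"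
    proof (rule DERIV_nonneg_imp_nondecreasing[OF that])
      fix u
      have "((\<lambda>x. f x - m * x) has_real_derivative f' u - m) (at u)"
        by (auto intro!: derivative_eq_intros der)
      then show "\<exists>y. ((\<lambda>x. f x - m * x) has_real_derivative y) (at u) \<and> 0 \<le> y"
        using m by force
    qed
    then show ?thesis by (simp add: algebra_simps)
  qed
  show "strict_mono f"
  proof (rule strict_monoI)
    fix x y :: real assume "x < y"
    then have "0 < m * (y - x)" using m by simp
    then show "f x < f y" using inc[of x y] \<open>x < y\<close> by linarith
  qed
  have cont: "continuous_on S f" for S
    using der by (intro continuous_at_imp_continuous_on ballI) (blast intro: DERIV_isCont)
  have "\<exists>x. f x = y" for y
  proof -
    \<comment> \<open>At growth rate at least m, a step of length N from 0 suffices to pass y on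
      either side.\<close>
    define N where "N = \<bar>y - f 0\<bar> / m"
    have N: "N \<ge> 0" "m * N = \<bar>y - f 0\<bar>" using m by (auto simp: N_def)
    have "f (- N) \<le> y" "y \<le> f N" using inc[of "-N" 0] inc[of 0 N] N by auto
    then show ?thesis using IVT'[of f "-N" y N] cont N by auto
  qed
  then show "surj f" by (metis surjI)
qed

section \<open>The angle swept between consecutive turning points\<close>

text \<open>The derivative of \<open>\<theta>\<close> with respect to the phase along the geodesic with \<open>cos (2 p(0)) = x\<close>.\<close>

definition turn_rate :: "real \<Rightarrow> real \<Rightarrow> real \<Rightarrow> real" where
  "turn_rate a x \<eta> = sqrt (1 - x\<^sup>2) * slope a (x * cos \<eta>) / (a * (1 - (x * cos \<eta>)\<^sup>2))"

text \<open>For x \<noteq> 0, consecutive turning points are the phases 0 and pi. The integral also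
  makes sense at x = 0, where the geodesic is the Clifford one and rho is constant.\<close>

definition half_turn :: "real \<Rightarrow> real \<Rightarrow> real" where
  "half_turn a x = integral {0..pi} (turn_rate a x)"

lemma abs_mult_cos_less: "\<bar>x\<bar> < 1 \<Longrightarrow> \<bar>x * cos \<eta>\<bar> < (1::real)"
  by (metis abs_cos_le_one abs_ge_zero abs_mult le_less_trans mult.right_neutral mult_left_mono)

lemma continuous_on_turn_rate [continuous_intros]:
  fixes f g h :: "'a::t2_space \<Rightarrow> real"
  assumes "continuous_on S f" "continuous_on S g" "continuous_on S h"
    and "\<And>z. z \<in> S \<Longrightarrow> 0 < f z" "\<And>z. z \<in> S \<Longrightarrow> \<bar>g z\<bar> < 1"
  shows "continuous_on S (\<lambda>z. turn_rate (f z) (g z) (h z))"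
proof -
  have "(g z * cos (h z))\<^sup>2 < 1" if "z \<in> S" for z
    using abs_mult_cos_less[OF assms(5)[OF that]] by (simp add: abs_square_less_1)
  then show ?thesis unfolding turn_rate_def using assms
    by (intro continuous_intros) (auto simp: less_le)
qed

text \<open>Continuity across x = 0 is the point: the branches start on the trivial branch, where x
  = 0.\<close>

lemma continuous_on_half_turn:
  "continuous_on ({0<..} \<times> {-1<..<1}) (\<lambda>(a, x). half_turn a x)"
  unfolding half_turn_def interval_cbox case_prod_beta
  by (intro integral_continuous_on_param) (auto simp: case_prod_beta intro!: continuous_intros)

lemma turn_rate_pos: "a > 0 \<Longrightarrow> \<bar>x\<bar> < 1 \<Longrightarrow> turn_rate a x \<eta> > 0"
  unfolding turn_rate_def using abs_mult_cos_less[of x \<eta>]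
  by (intro divide_pos_pos mult_pos_pos slope_pos) (auto simp: abs_square_less_1)

lemma half_turn_primitive:
  assumes "a > 0" "\<bar>x\<bar> < 1"
  shows "primitive (turn_rate a x) (real m * pi) = real m * half_turn a x"
proof -
  have c: "continuous_on UNIV (turn_rate a x)" using assms by (intro continuous_intros) auto
  have "primitive (turn_rate a x) (real m * pi) = real m * primitive (turn_rate a x) pi"
    by (rule primitive_multiple_half_period[OF c]) (simp_all add: turn_rate_def)
  then show ?thesis by (simp add: half_turn_def primitive_eq_integral[OF c])
qed

lemma half_turn_pos:
  assumes "a > 0" "\<bar>x\<bar> < 1"
  shows "half_turn a x > 0"
proof -
  have c: "continuous_on UNIV (turn_rate a x)" using assms by (intro continuous_intros) auto
  have "primitive (turn_rate a x) 0 < primitive (turn_rate a x) pi"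
    using strict_mono_primitive[OF c turn_rate_pos[OF assms]] by (rule strict_monoD) simp
  then show ?thesis by (simp add: half_turn_def primitive_eq_integral[OF c])
qed

text \<open>The integrand is constant at x = 0. By continuity, the value is the limiting angle
  between turning points for small oscillations about the Clifford geodesic.\<close>

lemma half_turn_0:
  assumes "a > 0"
  shows "half_turn a 0 = pi * sqrt (a\<^sup>2 + 1) / (2 * a)"
proof -
  have "slope a 0 = sqrt (a\<^sup>2 + 1) / 2"
    unfolding slope_def by (simp add: real_sqrt_divide)
  then show ?thesis using assms unfolding half_turn_def turn_rate_def by (simp add: field_simps)
qed

text \<open>\<open>a_bif j k\<close> is the positive solution of 2 a / sqrt (a^2 + 1) = j / k, so
  that j half oscillations in the limit x = 0 sweep the angle k pi.\<close>

lemma a_bif_half_turn: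
  assumes "0 < j" "j < 2 * k"
  shows "a_bif j k > 0" "real k * pi / half_turn (a_bif j k) 0 = real j"
proof -
  define q where "q = real j / real k"
  have q: "0 < q" "q < 2" using assms by (auto simp: q_def field_simps)
  have q2: "0 < 4 - q\<^sup>2" using q power_strict_mono[of q 2 2] by simp
  have a: "a_bif j k = q / sqrt (4 - q\<^sup>2)" by (simp add: a_bif_def q_def)
  show pos: "a_bif j k > 0" unfolding a using q q2 by simp
  have "(a_bif j k)\<^sup>2 + 1 = 4 / (4 - q\<^sup>2)"
    unfolding a using q2 by (simp add: power_divide field_simps)
  then have "sqrt ((a_bif j k)\<^sup>2 + 1) = 2 / sqrt (4 - q\<^sup>2)" by (simp add: real_sqrt_divide)
  then have "half_turn (a_bif j k) 0 = pi / q"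
    unfolding half_turn_0[OF pos] unfolding a using q q2 by (simp add: field_simps)
  then show "real k * pi / half_turn (a_bif j k) 0 = real j" using assms by (simp add: q_def)
qed

section \<open>The phase of a geodesic\<close>

text \<open>A single geodesic that leaves the diameter orthogonally at t = 0. The Clifford geodesic,
  with x 0 = 0, is included; statements about turning points and crossings add
  \<open>x 0 \<noteq> 0\<close>.\<close>

locale clifford_oscillation =
  fixes a :: real and \<rho> \<theta> :: "real \<Rightarrow> real"
  assumes a: "a > 0" and geod: "polar_geodesic a \<rho> \<theta>"
    and init: "deriv \<rho> 0 = 0" "\<theta> 0 = 0" "deriv \<theta> 0 = 1"
begin

definition p :: "real \<Rightarrow> real" where "p t = phi_of a (\<rho> t)"
definition x :: "real \<Rightarrow> real" where "x t = cos (2 * p t)"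
text \<open>\<open>pi * a * c\<close> is the value of \<open>warp\<close> at the start. As theta' =
  1 and rho' = 0 there, it is also the constant speed of the geodesic.\<close>

definition c :: real where "c = sin (2 * p 0)"
text \<open>The velocity rho', rescaled so that x' = - psi' y; then (x, y) moves on a
  circle.\<close>

definition y :: "real \<Rightarrow> real" where "y t = sin (2 * p t) * deriv \<rho> t / (pi * a * c)"
definition v :: "real \<Rightarrow> real" where "v t = slope a (x t)"
definition psi :: "real \<Rightarrow> real" where "psi = primitive (\<lambda>t. a * c / v t)"

section \<open>Ranges and derivatives of the coordinates along the geodesic\<close>

lemma rho_range: "0 < \<rho> t" "\<rho> t < L a"
  using geod by (auto simp: polar_geodesic_def)

lemma p_range: "0 < p t" "p t < pi / 2" and rho_of_p: "rho_of a (p t) = \<rho> t"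
  unfolding p_def using rho_of_phi_of[OF a rho_range] by auto

lemma sin_2p_pos: "sin (2 * p t) > 0"
  using p_range[of t] by (intro sin_gt_zero) auto

lemma c_pos: "c > 0"
  using sin_2p_pos by (simp add: c_def)

lemma sin_2p_sq: "(sin (2 * p t))\<^sup>2 = 1 - (x t)\<^sup>2"
  by (simp add: x_def sin_squared_eq)

lemma x_range: "\<bar>x t\<bar> < 1"
proof -
  have "(x t)\<^sup>2 < 1" using sin_2p_sq[of t] sin_2p_pos[of t] by (smt (verit) zero_less_power)
  then show ?thesis by (simp add: abs_square_less_1)
qed

lemma c_eq: "c = sqrt (1 - (x 0)\<^sup>2)"
  using sin_2p_sq[of 0] c_pos unfolding c_def by (metis less_imp_le real_sqrt_unique)

lemma v_pos: "v t > 0" and v_le: "v t \<le> sqrt (a\<^sup>2 + 1)"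
  unfolding v_def using x_range[of t] a by (auto intro!: slope_pos slope_le)

lemma speed_p: "speed a (p t) = v t"
  unfolding v_def x_def using p_range[of t] by (subst slope_cos_double) auto

lemma DERIV_rho: "(\<rho> has_real_derivative deriv \<rho> t) (at t)"
  and DERIV_theta: "(\<theta> has_real_derivative deriv \<theta> t) (at t)"
  using geod unfolding polar_geodesic_def by (auto simp: DERIV_deriv_iff_real_differentiable)

lemma DERIV_p: "(p has_real_derivative deriv \<rho> t / (2 * pi * v t)) (at t)"
proof -
  have "inverse (2 * pi * v t) * deriv \<rho> t = deriv \<rho> t / (2 * pi * v t)"
    by (simp only: divide_inverse mult.commute)
  with DERIV_chain2[OF DERIV_phi_of[OF a rho_range] DERIV_rho, of t] show ?thesis
    unfolding p_def[symmetric] speed_p by (simp only:)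
qed

lemma warp_rho: "warp a (\<rho> t) = pi * a * sin (2 * p t)"
  and deriv_warp_rho: "deriv (warp a) (\<rho> t) = a * x t / v t"
  using DERIV_imp_deriv[OF DERIV_warp[OF a rho_range, of t]]
  by (simp_all add: warp_def p_def[symmetric] speed_p x_def)

lemma DERIV_rho': "(deriv \<rho> has_real_derivative
    pi * a\<^sup>2 * sin (2 * p t) * x t / v t * (deriv \<theta> t)\<^sup>2) (at t)"
  using geod unfolding polar_geodesic_def warp_rho deriv_warp_rho
  by (auto simp: power2_eq_square mult_ac)

lemma DERIV_theta': "(deriv \<theta> has_real_derivative
    - 2 * x t * deriv \<rho> t * deriv \<theta> t / (pi * v t * sin (2 * p t))) (at t)"
proof -
  have "(deriv \<theta> has_real_derivative
     - 2 * (deriv (warp a) (\<rho> t) / warp a (\<rho> t)) * deriv \<rho> t * deriv \<theta> t) (at t)"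
    using geod unfolding polar_geodesic_def by blast
  also have "- 2 * (deriv (warp a) (\<rho> t) / warp a (\<rho> t)) * deriv \<rho> t * deriv \<theta> t =
     - 2 * x t * deriv \<rho> t * deriv \<theta> t / (pi * v t * sin (2 * p t))"
    unfolding warp_rho deriv_warp_rho using a by simp
  finally show ?thesis .
qed

section \<open>Clairaut's relation and conservation of energy\<close>

lemma DERIV_sin_2p: "((\<lambda>t. sin (2 * p t)) has_real_derivative x t * deriv \<rho> t / (pi * v t)) (at t)"
  using DERIV_chain2[OF DERIV_sin DERIV_cmult[OF DERIV_p, of 2], of t] by (simp add: x_def)

text \<open>The equation for theta says that warp^2 theta' is constant; dividing by (pi a)^2 leaves
  sin^2 (2 p) theta', which equals c^2 at t = 0.\<close>

lemma clairaut: "deriv \<theta> t = c\<^sup>2 / (sin (2 * p t))\<^sup>2"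
proof -
  have "((\<lambda>t. deriv \<theta> t * (sin (2 * p t))\<^sup>2) has_real_derivative 0) (at t)" for t
    using DERIV_mult[OF DERIV_theta' DERIV_power[OF DERIV_sin_2p, of 2], of t]
      sin_2p_pos[of t] v_pos[of t] by (simp add: power2_eq_square)
  from DERIV_isconst_all[rule_format, OF this, of t 0]
  have "deriv \<theta> t * (sin (2 * p t))\<^sup>2 = c\<^sup>2" by (simp add: init c_def)
  then show ?thesis using sin_2p_pos[of t] by (simp add: field_simps)
qed

text \<open>The squared speed rho'^2 + warp^2 theta'^2 is constant. By Clairaut's relation its
  second term is (pi a c)^2 theta', the form that is differentiated here.\<close>

lemma energy: "(deriv \<rho> t)\<^sup>2 = (pi * a * c)\<^sup>2 * (1 - c\<^sup>2 / (sin (2 * p t))\<^sup>2)"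
proof -
  have "((\<lambda>t. (deriv \<rho> t)\<^sup>2 + (pi * a * c)\<^sup>2 * deriv \<theta> t) has_real_derivative 0) (at t)" for t
  proof -
    have nz: "sin (2 * p t) \<noteq> 0" "v t \<noteq> 0" using sin_2p_pos[of t] v_pos[of t] by auto
    \<comment> \<open>Clairaut's relation read backwards: once c is eliminated, the derivative
      vanishes by algebra alone.\<close>
    have c2: "c\<^sup>2 = deriv \<theta> t * (sin (2 * p t))\<^sup>2" using clairaut[of t] nz by simp
    have "2 * deriv \<rho> t * (pi * a\<^sup>2 * sin (2 * p t) * x t / v t * (deriv \<theta> t)\<^sup>2)
       + (pi * a * c)\<^sup>2 * (- 2 * x t * deriv \<rho> t * deriv \<theta> t / (pi * v t * sin (2 * p t))) = 0"
      unfolding power_mult_distrib c2 using nz by (simp add: power2_eq_square)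
    then show ?thesis
      using DERIV_add[OF DERIV_power[OF DERIV_rho', of 2] DERIV_cmult[OF DERIV_theta', of "(pi * a * c)\<^sup>2"], of t]
      by (simp add: mult_ac)
  qed
  from DERIV_isconst_all[rule_format, OF this, of t 0]
  have "(deriv \<rho> t)\<^sup>2 + (pi * a * c)\<^sup>2 * deriv \<theta> t = (pi * a * c)\<^sup>2" by (simp add: init)
  then show ?thesis unfolding clairaut by (simp add: algebra_simps)
qed

section \<open>The oscillator equations for x and y\<close>

lemma DERIV_x: "(x has_real_derivative - (a * c / v t) * y t) (at t)"
proof -
  have "- sin (2 * p t) * (2 * (deriv \<rho> t / (2 * pi * v t))) = - (a * c / v t) * y t"
    unfolding y_def using a c_pos by simp
  with DERIV_chain2[OF DERIV_cos DERIV_cmult[OF DERIV_p, of 2], of t] show ?thesis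
    unfolding x_def[abs_def] by (simp only:)
qed

text \<open>The rho'^2 term contributes the factor 1 - theta' by \<open>energy\<close>, the geodesic
  equation for rho contributes theta' by \<open>clairaut\<close>; they add up to 1, leaving psi'
  x.\<close>

lemma DERIV_y: "(y has_real_derivative (a * c / v t) * x t) (at t)"
proof -
  have nz: "pi * a * c \<noteq> 0" "v t \<noteq> 0" "sin (2 * p t) \<noteq> 0" using a c_pos v_pos[of t] sin_2p_pos[of t] by auto
  have "(y has_real_derivative
     (x t * deriv \<rho> t / (pi * v t) * deriv \<rho> t
        + pi * a\<^sup>2 * sin (2 * p t) * x t / v t * (deriv \<theta> t)\<^sup>2 * sin (2 * p t)) / (pi * a * c)) (at t)"
    unfolding y_def[abs_def] by (intro DERIV_cdivide DERIV_mult DERIV_sin_2p DERIV_rho')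
  also have "x t * deriv \<rho> t / (pi * v t) * deriv \<rho> t = pi * (a * c)\<^sup>2 * x t / v t * (1 - deriv \<theta> t)"
  proof -
    have "x t * deriv \<rho> t / (pi * v t) * deriv \<rho> t = x t / (pi * v t) * (deriv \<rho> t)\<^sup>2"
      by (simp add: power2_eq_square)
    also have "\<dots> = pi * (a * c)\<^sup>2 * x t / v t * (1 - deriv \<theta> t)"
      unfolding energy clairaut[symmetric] by (simp add: power2_eq_square)
    finally show ?thesis .
  qed
  also have "pi * a\<^sup>2 * sin (2 * p t) * x t / v t * (deriv \<theta> t)\<^sup>2 * sin (2 * p t)
      = pi * (a * c)\<^sup>2 * x t / v t * deriv \<theta> t"
  proof -
    have "deriv \<theta> t * (sin (2 * p t))\<^sup>2 = c\<^sup>2" unfolding clairaut using nz by simp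
    then have "pi * a\<^sup>2 * x t / v t * deriv \<theta> t * (deriv \<theta> t * (sin (2 * p t))\<^sup>2)
        = pi * a\<^sup>2 * x t / v t * deriv \<theta> t * c\<^sup>2" by simp
    then show ?thesis by (simp add: power2_eq_square mult_ac)
  qed
  also have "(pi * (a * c)\<^sup>2 * x t / v t * (1 - deriv \<theta> t) + pi * (a * c)\<^sup>2 * x t / v t * deriv \<theta> t)
      / (pi * a * c) = (a * c / v t) * x t"
    unfolding distrib_left[symmetric] using nz by (simp add: power2_eq_square)
  finally show ?thesis .
qed

lemma isCont_x: "isCont x t"
  by (rule DERIV_isCont[OF DERIV_x])

lemma continuous_on_x [continuous_intros]: "continuous_on S x"
  by (intro continuous_at_imp_continuous_on ballI isCont_x)

lemma DERIV_psi: "(psi has_real_derivative a * c / v t) (at t)"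
  unfolding psi_def
proof (rule DERIV_primitive)
  show "continuous_on UNIV (\<lambda>t. a * c / v t)"
    using v_pos unfolding v_def by (intro continuous_intros) (simp add: less_le)
qed

lemma psi_0 [simp]: "psi 0 = 0"
  by (simp add: psi_def)

text \<open>The pair \<open>(x, y)\<close> rotates with angular velocity \<open>psi'\<close>, so it is constant in the rotating frame.\<close>

lemma rotation: "x t = x 0 * cos (psi t)" "y t = x 0 * sin (psi t)"
proof -
  have y0: "y 0 = 0" by (simp add: y_def init)
  note cos = DERIV_chain2[OF DERIV_cos DERIV_psi] and sin = DERIV_chain2[OF DERIV_sin DERIV_psi]
  have "((\<lambda>t. x t * cos (psi t) + y t * sin (psi t)) has_real_derivative 0) (at t)" for t
    using DERIV_add[OF DERIV_mult[OF DERIV_x cos] DERIV_mult[OF DERIV_y sin], of t]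
    by (simp add: mult_ac)
  from DERIV_isconst_all[rule_format, OF this, of t 0]
  have 1: "x t * cos (psi t) + y t * sin (psi t) = x 0" by simp
  have "((\<lambda>t. y t * cos (psi t) - x t * sin (psi t)) has_real_derivative 0) (at t)" for t
    using DERIV_diff[OF DERIV_mult[OF DERIV_y cos] DERIV_mult[OF DERIV_x sin], of t]
    by (simp add: mult_ac)
  from DERIV_isconst_all[rule_format, OF this, of t 0]
  have 2: "y t * cos (psi t) - x t * sin (psi t) = 0" using y0 by simp
  have 3: "(cos (psi t))\<^sup>2 + (sin (psi t))\<^sup>2 = 1" by simp
  have "x t * ((cos (psi t))\<^sup>2 + (sin (psi t))\<^sup>2) = (x t * cos (psi t) + y t * sin (psi t)) * cos (psi t)
      - (y t * cos (psi t) - x t * sin (psi t)) * sin (psi t)"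
    by (simp only: power2_eq_square algebra_simps)
  then show "x t = x 0 * cos (psi t)" unfolding 1 2 3 by simp
  have "y t * ((cos (psi t))\<^sup>2 + (sin (psi t))\<^sup>2) = (x t * cos (psi t) + y t * sin (psi t)) * sin (psi t)
      + (y t * cos (psi t) - x t * sin (psi t)) * cos (psi t)"
    by (simp only: power2_eq_square algebra_simps)
  then show "y t = x 0 * sin (psi t)" unfolding 1 2 3 by simp
qed

section \<open>Phase and angle as global parameters\<close>

lemma psi_strict_mono: "strict_mono psi" and surj_psi: "surj psi"
proof -
  \<comment> \<open>The bound \<open>v_le\<close> keeps psi' away from 0.\<close>
  have "0 < a * c / sqrt (a\<^sup>2 + 1)"
    using a c_pos by (intro divide_pos_pos mult_pos_pos real_sqrt_gt_zero add_pos_pos) auto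
  moreover have "a * c / sqrt (a\<^sup>2 + 1) \<le> a * c / v t" for t
    using a c_pos v_pos v_le by (intro divide_left_mono mult_pos_pos real_sqrt_gt_zero add_pos_pos) auto
  ultimately show "strict_mono psi" "surj psi" using DERIV_ge_imp_bij[OF DERIV_psi] by blast+
qed

text \<open>Clairaut's relation gives theta' \<ge> c^2 > 0. Each angle is thus attained exactly
  once, which makes \<open>ell\<close> well defined.\<close>

lemma theta_strict_mono: "strict_mono \<theta>" and surj_theta: "surj \<theta>"
proof -
  have "0 < c\<^sup>2" using c_pos by simp
  moreover have "c\<^sup>2 \<le> deriv \<theta> t" for t
  proof -
    have "(sin (2 * p t))\<^sup>2 \<le> 1" "0 < (sin (2 * p t))\<^sup>2"
      using sin_2p_pos[of t] by (simp_all add: abs_square_le_1)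
    then have "c\<^sup>2 * (sin (2 * p t))\<^sup>2 \<le> c\<^sup>2 * 1" by (intro mult_left_mono) auto
    then show ?thesis unfolding clairaut using \<open>0 < (sin (2 * p t))\<^sup>2\<close> by (simp add: pos_le_divide_eq)
  qed
  ultimately show "strict_mono \<theta>" "surj \<theta>" using DERIV_ge_imp_bij[OF DERIV_theta] by blast+
qed

lemma continuous_on_turn: "continuous_on UNIV (turn_rate a (x 0))"
  using a x_range by (intro continuous_intros) auto

text \<open>\<open>turn_rate\<close> is theta' = c^2 / sin^2 (2 p) divided by psi' = a c / v, with
  c, sin (2 p) and v expressed through x 0 and x = x 0 cos psi.\<close>

lemma theta_eq: "\<theta> t = primitive (turn_rate a (x 0)) (psi t)"
proof (rule primitive_unique[OF DERIV_theta])
  fix t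
  have "(sin (2 * p t))\<^sup>2 \<noteq> 0" using sin_2p_pos[of t] by simp
  then have "turn_rate a (x 0) (psi t) * (a * c / v t) = deriv \<theta> t"
    unfolding turn_rate_def rotation[symmetric] c_eq[symmetric] clairaut sin_2p_sq v_def[symmetric]
    using a c_pos v_pos[of t] by (simp add: field_simps power2_eq_square)
  then show "((\<lambda>t. primitive (turn_rate a (x 0)) (psi t)) has_real_derivative deriv \<theta> t) (at t)"
    using DERIV_chain2[OF DERIV_primitive[OF continuous_on_turn] DERIV_psi, of t] by simp
qed (simp add: init)

lemma theta_at_half_periods:
  assumes "psi t = real m * pi"
  shows "\<theta> t = real m * half_turn a (x 0)"
  using half_turn_primitive[OF a x_range, of 0 m] assms by (simp add: theta_eq)

text \<open>The time elapsed is a primitive, in the phase, of an even function.\<close>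

lemma psi_odd: "psi (- t) = - psi t"
proof -
  \<comment> \<open>g is 1 / psi' as a function of the phase, hence the derivative of time with
    respect to phase.\<close>
  define g where "g \<eta> = slope a (x 0 * cos \<eta>) / (a * c)" for \<eta>
  have g: "continuous_on UNIV g" unfolding g_def using a c_pos by (intro continuous_intros) auto
  have gpos: "g \<eta> > 0" for \<eta>
    unfolding g_def using abs_mult_cos_less[OF x_range, of 0 \<eta>] a c_pos
    by (intro divide_pos_pos slope_pos) auto
  have time: "primitive g (psi t) = t" for t
  proof (rule primitive_unique[where F' = "\<lambda>_. 1" and G = "\<lambda>t. t"])
    fix t
    have "g (psi t) * (a * c / v t) = 1"
      unfolding g_def rotation[symmetric] v_def[symmetric] using a c_pos v_pos[of t] by simp
    with DERIV_chain2[OF DERIV_primitive[OF g] DERIV_psi, of t]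
    show "((\<lambda>t. primitive g (psi t)) has_real_derivative 1) (at t)" by (simp only:)
  qed auto
  have "inj (primitive g)" using strict_mono_primitive[OF g gpos] by (rule strict_mono_imp_inj_on)
  moreover have "primitive g (psi (- t)) = primitive g (- psi t)"
    using primitive_odd[OF g] by (simp add: time g_def)
  ultimately show ?thesis by (simp add: inj_eq)
qed

text \<open>Together with \<open>p_even\<close> this says that reflection in the diameter through
  the starting point reverses the geodesic in time.\<close>

lemma theta_odd: "\<theta> (- t) = - \<theta> t"
  unfolding theta_eq psi_odd by (intro primitive_odd continuous_on_turn) (simp add: turn_rate_def)

lemma p_even: "p (- t) = p t"
proof -
  have "x (- t) = x t" by (simp add: rotation[of t] rotation[of "- t"] psi_odd)
  then show ?thesis unfolding x_def
    using cos_inj_pi[of "2 * p (- t)" "2 * p t"] p_range[of t] p_range[of "- t"] by simp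
qed

lemma psi_pos: "psi t > 0 \<longleftrightarrow> t > 0"
  using strict_mono_less[OF psi_strict_mono, of 0 t] by simp

lemma theta_pos: "\<theta> t > 0 \<longleftrightarrow> t > 0"
  using strict_mono_less[OF theta_strict_mono, of 0 t] by (simp add: init)

lemma ex1_theta:
  assumes "k > 0"
  shows "\<exists>!l. 0 < l \<and> \<theta> l = real k * pi"
proof -
  obtain l where l: "\<theta> l = real k * pi" using surj_theta by (metis surjD)
  then have "0 < l" using theta_pos[of l] assms by simp
  moreover have "l' = l" if "\<theta> l' = real k * pi" for l'
    using that l strict_mono_eq[OF theta_strict_mono, of l' l] by simp
  ultimately show ?thesis using l by blast
qed

lemma deriv_rho_0_iff: "x 0 \<noteq> 0 \<Longrightarrow> deriv \<rho> t = 0 \<longleftrightarrow> sin (psi t) = 0"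
  using rotation(2)[of t] sin_2p_pos[of t] a c_pos unfolding y_def by auto

text \<open>A zero of rho' has phase i pi for an integer i, and each half period sweeps
  \<open>half_turn\<close>, so k pi = i times \<open>half_turn\<close>. Positivity of the time makes
  i positive.\<close>

lemma turning_point:
  assumes "x 0 \<noteq> 0" "0 < l" "\<theta> l = real k * pi" "deriv \<rho> l = 0"
  shows "real k * pi / half_turn a (x 0) \<in> \<int>"
proof -
  obtain i :: int where i: "psi l = of_int i * pi"
    using deriv_rho_0_iff[of l] assms by (auto simp: sin_zero_iff_int2)
  have "psi l > 0" using assms psi_pos by simp
  then have "i > 0" using i by (simp add: zero_less_mult_iff)
  then have "psi l = real (nat i) * pi" using i by simp
  from theta_at_half_periods[OF this] have "real k * pi = real (nat i) * half_turn a (x 0)" using assms by simp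
  then show ?thesis using half_turn_pos[OF a x_range, of 0] by simp
qed

section \<open>The curve in the orbit space\<close>

lemma curve_eq: "curve a \<rho> \<theta> t = (of_real a * cis (\<theta> t) * of_real (sin (p t)), cos (p t))"
  by (simp add: curve_def pt_def p_def)

lemma sin_p_pos: "sin (p t) > 0"
  using p_range[of t] by (intro sin_gt_zero) auto

lemma curve_in_Omega: "curve a \<rho> \<theta> t \<in> Omega a"
proof -
  have "cos (p t) \<ge> 0" using p_range[of t] by (intro cos_ge_zero) auto
  moreover have "(cmod (of_real a * cis (\<theta> t) * of_real (sin (p t))))\<^sup>2 / a\<^sup>2 = (sin (p t))\<^sup>2"
    using a by (simp add: norm_mult power_mult_distrib)
  ultimately show ?thesis by (simp add: curve_eq Omega_def)
qed

text \<open>At a turning point p' = 0, so only the rotation of the angle contributes to the tangent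
  vector.\<close>

lemma curve_has_vector_derivative:
  assumes "deriv \<rho> t = 0"
  shows "(curve a \<rho> \<theta> has_vector_derivative
    (of_real a * (of_real (deriv \<theta> t) * (\<i> * cis (\<theta> t))) * of_real (sin (p t)), 0)) (at t)"
proof -
  have p: "(p has_real_derivative 0) (at t)" using DERIV_p[of t] assms by simp
  have cis: "((\<lambda>t. cis (\<theta> t)) has_vector_derivative deriv \<theta> t *\<^sub>R (\<i> * cis (\<theta> t))) (at t)"
  proof -
    have 1: "((\<lambda>t. exp (\<i> * of_real t)) has_vector_derivative \<i> * cis (\<theta> t)) (at (\<theta> t))"
      unfolding cis_conv_exp
      by (rule has_vector_derivative_real_field) (auto intro!: derivative_eq_intros)
    have "((\<lambda>t. exp (\<i> * of_real t)) \<circ> \<theta> has_vector_derivative deriv \<theta> t *\<^sub>R (\<i> * cis (\<theta> t))) (at t)"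
      using DERIV_theta[of t] 1
      by (intro vector_diff_chain_at) (simp_all add: has_real_derivative_iff_has_vector_derivative)
    then show ?thesis by (simp add: o_def cis_conv_exp)
  qed
  have sin: "((\<lambda>t. complex_of_real (sin (p t))) has_vector_derivative 0) (at t)"
    using has_vector_derivative_of_real[OF DERIV_chain2[OF DERIV_sin p]] by simp
  have cos: "((\<lambda>t. cos (p t)) has_vector_derivative 0) (at t)"
    using DERIV_chain2[OF DERIV_cos p] by (simp add: has_real_derivative_iff_has_vector_derivative)
  have "((\<lambda>t. of_real a * cis (\<theta> t) * of_real (sin (p t))) has_vector_derivative
      of_real a * (of_real (deriv \<theta> t) * (\<i> * cis (\<theta> t))) * of_real (sin (p t))) (at t)"
    using has_vector_derivative_mult[OF has_vector_derivative_mult_right[OF cis] sin, of "of_real a"]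
    by (simp add: scaleR_conv_of_real)
  then show ?thesis
    unfolding curve_eq[abs_def] using cos by (rule has_vector_derivative_Pair)
qed

text \<open>The Clifford geodesic lies at p = pi / 4, that is x = 0, and x = x 0 cos psi.\<close>

lemma crossing_iff:
  assumes "x 0 \<noteq> 0"
  shows "\<rho> t = rho0 a \<longleftrightarrow> cos (psi t) = 0"
proof -
  have "\<rho> t = rho0 a \<longleftrightarrow> p t = pi / 4"
  proof
    assume "\<rho> t = rho0 a"
    then show "p t = pi / 4" using a by (simp add: p_def rho0_def phi_of_rho_of)
  next
    assume "p t = pi / 4"
    then show "\<rho> t = rho0 a" unfolding rho0_def by (metis rho_of_p)
  qed
  also have "\<dots> \<longleftrightarrow> x t = 0"
  proof
    assume "p t = pi / 4"
    then have "2 * p t = pi / 2" by simp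
    then show "x t = 0" unfolding x_def by (metis cos_pi_half)
  next
    assume "x t = 0"
    then have "2 * p t = pi / 2"
      using cos_inj_pi[of "2 * p t" "pi / 2"] p_range[of t] by (simp add: x_def)
    then show "p t = pi / 4" by simp
  qed
  also have "\<dots> \<longleftrightarrow> cos (psi t) = 0"
    using rotation(1)[of t] assms by simp
  finally show ?thesis .
qed

end

section \<open>Closed geodesics\<close>

text \<open>The zeros are i pi + pi / 2 for integers i with -j \<le> i < j: the endpoints are
  multiples of pi, hence no zeros, and each side of 0 holds j of them.\<close>

lemma card_cos_zeros:
  "card {\<eta> \<in> {- (real j * pi)..real j * pi}. cos \<eta> = 0} = 2 * j"
proof -
  have "{\<eta> \<in> {- (real j * pi)..real j * pi}. cos \<eta> = 0}
      = (\<lambda>i::int. of_int i * pi + pi / 2) ` {- int j..<int j}"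
  proof (intro equalityI subsetI)
    fix \<eta> assume "\<eta> \<in> {\<eta> \<in> {- (real j * pi)..real j * pi}. cos \<eta> = 0}"
    then obtain i :: int where i: "\<eta> = of_int i * pi + pi / 2"
      and \<eta>: "- (real j * pi) \<le> \<eta>" "\<eta> \<le> real j * pi"
      by (auto simp: cos_zero_iff_int2)
    have "- real j * pi \<le> (of_int i + 1 / 2) * pi" "(of_int i + 1 / 2) * pi \<le> real j * pi"
      using \<eta> unfolding i by (simp_all add: algebra_simps)
    then have "- real j \<le> of_int i + 1 / 2" "of_int i + 1 / 2 \<le> real j"
      by (simp_all only: mult_le_cancel_right_pos[OF pi_gt_zero])
    then have "- int j \<le> i" "i < int j" by linarith+
    then show "\<eta> \<in> (\<lambda>i::int. of_int i * pi + pi / 2) ` {- int j..<int j}" using i by auto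
  next
    fix \<eta> assume "\<eta> \<in> (\<lambda>i::int. of_int i * pi + pi / 2) ` {- int j..<int j}"
    then obtain i :: int where i: "- int j \<le> i" "i < int j" "\<eta> = of_int i * pi + pi / 2" by auto
    have "- real j \<le> of_int i + 1 / 2" "of_int i + 1 / 2 \<le> real j" using i by linarith+
    then have "- real j * pi \<le> (of_int i + 1 / 2) * pi" "(of_int i + 1 / 2) * pi \<le> real j * pi"
      by (simp_all only: mult_le_cancel_right_pos[OF pi_gt_zero])
    moreover have "(of_int i + 1 / 2) * pi = \<eta>" using i by (simp add: algebra_simps)
    moreover have "cos \<eta> = 0" using i(3) cos_zero_iff_int2 by blast
    ultimately show "\<eta> \<in> {\<eta> \<in> {- (real j * pi)..real j * pi}. cos \<eta> = 0}" by simp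
  qed
  moreover have "inj_on (\<lambda>i::int. of_int i * pi + pi / 2) {- int j..<int j}"
    by (intro inj_onI) simp
  ultimately show ?thesis by (simp add: card_image)
qed

text \<open>The resonance condition says that j half oscillations sweep the angle k pi; l plays the
  role of \<open>ell\<close>.\<close>

locale closed_clifford_oscillation = clifford_oscillation +
  fixes j k :: nat and l :: real
  assumes x0: "x 0 \<noteq> 0" and j: "0 < j" and k: "0 < k"
    and resonance: "real j * half_turn a (x 0) = real k * pi"
    and theta_l: "\<theta> l = real k * pi"
begin

lemma l_pos: "0 < l"
  using theta_pos[of l] theta_l k by simp

text \<open>At phase j pi the angle is k pi by resonance, and the angle determines the time.\<close>

lemma psi_l: "psi l = real j * pi"
proof -
  obtain t where t: "psi t = real j * pi" using surj_psi by (metis surjD)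
  then have "\<theta> t = \<theta> l" using theta_at_half_periods[OF t] resonance theta_l by simp
  then show ?thesis using t strict_mono_eq[OF theta_strict_mono, of t l] by simp
qed

text \<open>The instants -l and l are turning points with equal p and angles -k pi and k pi, which
  differ by a multiple of 2 pi; so positions and velocities agree.\<close>

lemma closed: "closed_geodesic_on a \<rho> \<theta> (- l) l"
proof -
  define w where "w t = (of_real a * (of_real (deriv \<theta> t) * (\<i> * cis (\<theta> t))) * complex_of_real (sin (p t)), 0::real)" for t
  have cis: "cis (\<theta> (- l)) = cis (\<theta> l)"
    unfolding theta_odd theta_l by (simp add: complex_eq_iff)
  have d: "deriv \<rho> l = 0" "deriv \<rho> (- l) = 0"
    using deriv_rho_0_iff[OF x0, of l] deriv_rho_0_iff[OF x0, of "- l"] by (simp_all add: psi_odd psi_l)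
  have "deriv \<theta> (- l) = deriv \<theta> l" by (simp add: clairaut p_even)
  then have w: "w (- l) = w l" by (simp add: w_def cis p_even)
  have "deriv \<theta> l \<noteq> 0" using clairaut[of l] c_pos sin_2p_pos[of l] by simp
  then have "w l \<noteq> 0" using a sin_p_pos[of l] by (simp add: w_def zero_prod_def)
  moreover have "(curve a \<rho> \<theta> has_vector_derivative w l) (at (- l))"
    using curve_has_vector_derivative[OF d(2)] unfolding w_def[symmetric] w .
  moreover have "(curve a \<rho> \<theta> has_vector_derivative w l) (at l)"
    using curve_has_vector_derivative[OF d(1)] unfolding w_def[symmetric] .
  moreover have "curve a \<rho> \<theta> (- l) = curve a \<rho> \<theta> l" by (simp add: curve_eq cis p_even)
  ultimately show ?thesis
    unfolding closed_geodesic_on_def using l_pos geod curve_in_Omega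
    by (intro conjI exI[of _ "w l"]) auto
qed

text \<open>The phase maps [-l, l] bijectively onto [-j pi, j pi] and crossings to zeros of the
  cosine.\<close>

lemma card_crossings: "card {t \<in> {- l..l}. \<rho> t = rho0 a} = 2 * j"
proof -
  have "psi ` {t \<in> {- l..l}. \<rho> t = rho0 a} = {\<eta> \<in> {- (real j * pi)..real j * pi}. cos \<eta> = 0}"
  proof (intro equalityI subsetI)
    fix \<eta> assume "\<eta> \<in> psi ` {t \<in> {- l..l}. \<rho> t = rho0 a}"
    then show "\<eta> \<in> {\<eta> \<in> {- (real j * pi)..real j * pi}. cos \<eta> = 0}"
      using crossing_iff[OF x0] strict_mono_less_eq[OF psi_strict_mono]
      by (auto simp: psi_l[symmetric] psi_odd[symmetric])
  next
    fix \<eta> assume \<eta>: "\<eta> \<in> {\<eta> \<in> {- (real j * pi)..real j * pi}. cos \<eta> = 0}"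
    obtain t where "\<eta> = psi t" using surj_psi by (metis surjD)
    then show "\<eta> \<in> psi ` {t \<in> {- l..l}. \<rho> t = rho0 a}"
      using \<eta> crossing_iff[OF x0] strict_mono_less_eq[OF psi_strict_mono]
      by (auto simp: psi_l[symmetric] psi_odd[symmetric])
  qed
  then show ?thesis
    using card_image[OF strict_mono_imp_inj_on[OF psi_strict_mono], of "{t \<in> {- l..l}. \<rho> t = rho0 a}"]
      card_cos_zeros[of j] by (simp only:)
qed

lemma winding: "winding_about_O (curve a \<rho> \<theta>) (- l) l = of_nat k"
proof -
  \<comment> \<open>A continuous logarithm of the projected curve. Its real part is even in time, so
    only the angle contributes to the increment, which is 2 pi k times the imaginary unit.\<close>
  define q where "q u = complex_of_real (ln (a * sin (p u))) + \<i> * of_real (\<theta> u)" for u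
  have eq: "exp (q u) = fst (curve a \<rho> \<theta> u)" for u
    unfolding q_def exp_add
    using a sin_p_pos[of u] by (simp add: curve_eq exp_of_real cis_conv_exp)
  have cp: "continuous_on UNIV p" and ct: "continuous_on UNIV \<theta>"
    by (intro continuous_at_imp_continuous_on ballI DERIV_isCont[OF DERIV_p] DERIV_isCont[OF DERIV_theta])+
  have "continuous_on UNIV q"
    unfolding q_def using a sin_p_pos
    by (intro continuous_intros cp ct) (simp add: less_le)
  then have "path (q \<circ> linepath (- l) l)"
    unfolding path_def by (intro continuous_on_compose continuous_intros) (auto elim: continuous_on_subset)
  from winding_number_compose_exp[OF this]
  have "winding_number (exp \<circ> (q \<circ> linepath (- l) l)) 0 = (q l - q (- l)) / (2 * of_real pi * \<i>)"
    by (simp add: pathfinish_def pathstart_def linepath_def)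
  also have "exp \<circ> (q \<circ> linepath (- l) l) = fst \<circ> curve a \<rho> \<theta> \<circ> linepath (- l) l"
    by (rule ext) (simp add: eq)
  also have "q l - q (- l) = of_nat k * (2 * of_real pi * \<i>)"
    by (simp add: q_def p_even theta_odd theta_l algebra_simps)
  finally show ?thesis by (simp add: winding_about_O_def o_def)
qed

abbreviation self_intersections :: "real set" where
  "self_intersections \<equiv> {t \<in> {0<..<l}. curve a \<rho> \<theta> (- t) = curve a \<rho> \<theta> t \<and> curve a \<rho> \<theta> t \<in> diam0 a}"

text \<open>The points at t and -t have equal p and opposite angles. They coincide exactly when the
  angle is a multiple of pi, and then lie on the diameter.\<close>

lemma self_intersection_iff:
  "curve a \<rho> \<theta> (- t) = curve a \<rho> \<theta> t \<and> curve a \<rho> \<theta> t \<in> diam0 a \<longleftrightarrow> sin (\<theta> t) = 0"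
proof -
  have "curve a \<rho> \<theta> (- t) = curve a \<rho> \<theta> t \<longleftrightarrow> cis (- \<theta> t) = cis (\<theta> t)"
    using a sin_p_pos[of t] by (simp add: curve_eq p_even theta_odd)
  also have "\<dots> \<longleftrightarrow> sin (\<theta> t) = 0" by (auto simp: complex_eq_iff)
  finally have 1: "curve a \<rho> \<theta> (- t) = curve a \<rho> \<theta> t \<longleftrightarrow> sin (\<theta> t) = 0" .
  have "curve a \<rho> \<theta> t \<in> diam0 a" if s: "sin (\<theta> t) = 0"
  proof -
    have "(cos (\<theta> t))\<^sup>2 = 1" using s by (simp add: cos_squared_eq)
    then have "cos (\<theta> t) = 1 \<or> cos (\<theta> t) = - 1" by (simp add: power2_eq_1_iff)
    then have "cis (\<theta> t) = cis 0 \<or> cis (\<theta> t) = cis pi" using s by (auto simp: complex_eq_iff)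
    then have "curve a \<rho> \<theta> t = pt a (\<rho> t) 0 \<or> curve a \<rho> \<theta> t = pt a (\<rho> t) pi"
      by (auto simp: curve_def pt_def)
    then have "curve a \<rho> \<theta> t \<in> {pt a x y | x y. 0 < x \<and> x < L a \<and> (y = 0 \<or> y = pi)}"
      using rho_range by blast
    then show ?thesis unfolding diam0_def by (rule subsetD[OF closure_subset])
  qed
  then show ?thesis using 1 by blast
qed

text \<open>The angle maps these instants onto the multiples m pi with 0 < m < k. Finiteness is
  recorded because \<open>card\<close> of an infinite set is 0, the same value as k - 1 for k =
  1.\<close>

lemma finite_self_intersections: "finite self_intersections"
  and card_self_intersections: "card self_intersections = k - 1"
proof -
  have "\<theta> ` self_intersections = (\<lambda>m. real m * pi) ` {1..<k}"
  proof (intro equalityI subsetI)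
    fix u assume "u \<in> \<theta> ` self_intersections"
    then obtain t where t: "u = \<theta> t" "0 < t" "t < l" "sin (\<theta> t) = 0"
      using self_intersection_iff by auto
    then obtain i :: int where i: "\<theta> t = of_int i * pi" by (auto simp: sin_zero_iff_int2)
    have "0 < \<theta> t" "\<theta> t < real k * pi"
      using t theta_pos[of t] strict_monoD[OF theta_strict_mono, of t l] theta_l by auto
    then have "0 < i" "i < int k" unfolding i by (auto simp: zero_less_mult_iff)
    then show "u \<in> (\<lambda>m. real m * pi) ` {1..<k}"
      using i t by (intro image_eqI[of _ _ "nat i"]) auto
  next
    fix u assume "u \<in> (\<lambda>m. real m * pi) ` {1..<k}"
    then obtain m where m: "u = real m * pi" "0 < m" "m < k" by auto
    obtain t where t: "u = \<theta> t" using surj_theta by (metis surjD)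
    have tm: "\<theta> t = real m * pi" using t m by simp
    have "0 < t" using theta_pos[of t] m(2) unfolding tm by simp
    moreover have "t < l"
      using strict_mono_less[OF theta_strict_mono, of t l] m(3) unfolding tm theta_l by simp
    moreover have "sin (\<theta> t) = 0" unfolding tm by simp
    ultimately show "u \<in> \<theta> ` self_intersections" using t self_intersection_iff by auto
  qed
  moreover have inj: "inj_on \<theta> S" for S using strict_mono_imp_inj_on[OF theta_strict_mono] .
  ultimately have "finite (\<theta> ` self_intersections)" by simp
  then show "finite self_intersections" using inj finite_imageD by blast
  have "card self_intersections = card (\<theta> ` self_intersections)" using card_image[OF inj] by simp
  also have "\<dots> = card ((\<lambda>m. real m * pi) ` {1..<k})"
    using \<open>\<theta> ` self_intersections = _\<close> by simp
  also have "\<dots> = k - 1" by (subst card_image) (auto intro: inj_onI)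
  finally show "card self_intersections = k - 1" .
qed

end

section \<open>The rotation number on the branches\<close>

text \<open>The value x 0 of the geodesic for (a, s), written through \<beta> alone so that its
  continuity in (a, s) can be studied.\<close>

definition start_height :: "(real \<Rightarrow> real \<Rightarrow> real) \<Rightarrow> real \<times> real \<Rightarrow> real" where
  "start_height \<beta> = (\<lambda>(a, s). cos (2 * phi_of a (\<beta> a s)))"

text \<open>The number of half oscillations per angle pi; it takes the value j / k on the branch of
  (j, k).\<close>

definition rotation_number :: "(real \<Rightarrow> real \<Rightarrow> real) \<Rightarrow> real \<times> real \<Rightarrow> real" where
  "rotation_number \<beta> z = pi / half_turn (fst z) (start_height \<beta> z)"

context
  fixes \<beta> :: "real \<Rightarrow> real \<Rightarrow> real" and \<rho> \<theta> :: "real \<Rightarrow> real \<Rightarrow> real \<Rightarrow> real"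
  assumes \<beta>: "admissible_beta \<beta>" and fam: "geodesic_family \<beta> \<rho> \<theta>"
begin

section \<open>Continuity of the rotation number in the parameters\<close>

lemma beta_range:
  assumes "(a, s) \<in> param_domain"
  shows "0 < \<beta> a s" "\<beta> a s < L a"
proof -
  have "\<beta> a s \<in> \<beta> a ` {-1<..<1}" using assms by (auto simp: param_domain_def)
  also have "\<beta> a ` {-1<..<1} = {0<..<L a}"
    using \<beta> assms by (auto simp: admissible_beta_def param_domain_def bij_betw_def)
  finally show "0 < \<beta> a s" "\<beta> a s < L a" by auto
qed

lemma start_height_less_1:
  assumes "z \<in> param_domain"
  shows "\<bar>start_height \<beta> z\<bar> < 1"
proof -
  obtain a s where z: "z = (a, s)" by fastforce
  have a: "a > 0" using assms z by (auto simp: param_domain_def)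
  have "sin (2 * phi_of a (\<beta> a s)) > 0"
    using rho_of_phi_of[OF a beta_range, of s] assms z by (intro sin_gt_zero) auto
  then have "(cos (2 * phi_of a (\<beta> a s)))\<^sup>2 < 1"
    using cos_squared_eq[of "2 * phi_of a (\<beta> a s)"] by simp
  then show ?thesis by (simp add: z start_height_def abs_square_less_1)
qed

lemma continuous_on_start_height: "continuous_on param_domain (start_height \<beta>)"
  unfolding continuous_on_def
proof
  fix z assume z: "z \<in> param_domain"
  obtain a s where as: "z = (a, s)" by fastforce
  have "isCont (\<lambda>(a, s). \<beta> a s) z"
    using \<beta> z by (intro real_analytic2_isCont) (auto simp: admissible_beta_def)
  then have "((\<lambda>z. \<beta> (fst z) (snd z)) \<longlongrightarrow> \<beta> a s) (at z within param_domain)"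
    unfolding isCont_def as by (auto simp: case_prod_unfold intro: tendsto_within_subset)
  then have "((\<lambda>z. phi_of (fst z) (\<beta> (fst z) (snd z))) \<longlongrightarrow> phi_of a (\<beta> a s)) (at z within param_domain)"
    using z beta_range[of a s] unfolding as
    by (intro tendsto_phi_of) (auto simp: param_domain_def intro!: tendsto_eq_intros)
  then show "(start_height \<beta> \<longlongrightarrow> start_height \<beta> z) (at z within param_domain)"
    unfolding start_height_def case_prod_beta as by (intro tendsto_intros) simp
qed

lemma continuous_on_rotation_number: "continuous_on param_domain (rotation_number \<beta>)"
proof -
  have "continuous_on param_domain (\<lambda>z. (\<lambda>(a, x). half_turn a x) (fst z, start_height \<beta> z))"
  proof (rule continuous_on_compose2[OF continuous_on_half_turn])
    show "continuous_on param_domain (\<lambda>z. (fst z, start_height \<beta> z))"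
      by (intro continuous_intros continuous_on_start_height)
    show "(\<lambda>z. (fst z, start_height \<beta> z)) ` param_domain \<subseteq> {0<..} \<times> {-1<..<1}"
    proof
      fix w assume "w \<in> (\<lambda>z. (fst z, start_height \<beta> z)) ` param_domain"
      then obtain z where z: "z \<in> param_domain" "w = (fst z, start_height \<beta> z)" by blast
      then show "w \<in> {0<..} \<times> {-1<..<1}"
        using start_height_less_1[OF z(1)] by (auto simp: param_domain_def abs_less_iff)
    qed
  qed
  moreover have "half_turn (fst z) (start_height \<beta> z) \<noteq> 0" if "z \<in> param_domain" for z
    using half_turn_pos[of "fst z" "start_height \<beta> z"] start_height_less_1[OF that] that
    by (auto simp: param_domain_def)
  ultimately show ?thesis
    unfolding rotation_number_def by (intro continuous_intros) auto
qed

section \<open>Zeros of the bifurcation function and the branches\<close>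

lemma oscillation:
  assumes "(a, s) \<in> param_domain"
  shows "clifford_oscillation a (\<rho> a s) (\<theta> a s)"
    and "clifford_oscillation.x a (\<rho> a s) 0 = start_height \<beta> (a, s)"
proof -
  show 1: "clifford_oscillation a (\<rho> a s) (\<theta> a s)"
    using fam assms unfolding geodesic_family_def clifford_oscillation_def param_domain_def by auto
  show "clifford_oscillation.x a (\<rho> a s) 0 = start_height \<beta> (a, s)"
    unfolding clifford_oscillation.x_def[OF 1] clifford_oscillation.p_def[OF 1]
    using fam assms by (auto simp: geodesic_family_def start_height_def)
qed

text \<open>\<open>\<beta> a\<close> is injective and sends 0 to the Clifford radius, so no other s
  starts on the Clifford geodesic.\<close>

lemma start_height_nonzero:
  assumes "(a, s) \<in> param_domain" "s \<noteq> 0"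
  shows "start_height \<beta> (a, s) \<noteq> 0"
proof
  have a: "a > 0" using assms by (auto simp: param_domain_def)
  note P = rho_of_phi_of[OF a beta_range[OF assms(1)]]
  assume "start_height \<beta> (a, s) = 0"
  then have "2 * phi_of a (\<beta> a s) = pi / 2"
    using cos_inj_pi[of "2 * phi_of a (\<beta> a s)" "pi / 2"] P by (simp add: start_height_def)
  then have "phi_of a (\<beta> a s) = pi / 4" by simp
  then have "\<beta> a s = rho_of a (pi / 4)" using P(1) by metis
  then have "\<beta> a s = \<beta> a 0" using \<beta> a by (simp add: admissible_beta_def rho0_def)
  moreover have "inj_on (\<beta> a) {-1<..<1}" using \<beta> a by (auto simp: admissible_beta_def bij_betw_def)
  ultimately have "s = 0" using assms by (auto simp: param_domain_def dest: inj_onD)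
  then show False using assms by simp
qed

lemma ell_props:
  assumes "(a, s) \<in> param_domain" "k > 0"
  shows "0 < ell \<theta> k a s" "\<theta> a s (ell \<theta> k a s) = real k * pi"
  using theI'[OF clifford_oscillation.ex1_theta[OF oscillation(1)[OF assms(1)] assms(2)]]
  by (auto simp: ell_def)

text \<open>At nontrivial zeros this is \<open>turning_point\<close>. Continuity of the rotation
  number and closedness of the integers carry it to limit points, including those on the trivial
  branch.\<close>

lemma rotation_number_integral_on_zeros:
  assumes z: "z \<in> param_domain \<inter> closure ({(a, s) \<in> param_domain. bif_fun \<rho> \<theta> k a s = 0} - triv_branch)"
    and k: "k > 0"
  shows "real k * rotation_number \<beta> z \<in> \<int>"
proof -
  let ?Z = "{(a, s) \<in> param_domain. bif_fun \<rho> \<theta> k a s = 0} - triv_branch"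
  have on_Z: "real k * rotation_number \<beta> (a, s) \<in> \<int>" if "(a, s) \<in> ?Z" for a s
  proof -
    have as: "(a, s) \<in> param_domain" "s \<noteq> 0" using that by (auto simp: param_domain_def triv_branch_def)
    interpret clifford_oscillation a "\<rho> a s" "\<theta> a s" by (rule oscillation(1)[OF as(1)])
    show ?thesis
      using turning_point[OF _ ell_props[OF as(1) k]] start_height_nonzero[OF as] that
      by (simp add: oscillation(2)[OF as(1)] bif_fun_def rotation_number_def)
  qed
  have "closedin (top_of_set param_domain) {z \<in> param_domain. real k * rotation_number \<beta> z \<in> \<int>}"
    using continuous_closedin_preimage[OF continuous_on_mult_left[OF continuous_on_rotation_number] closed_Ints, of "real k"]
    by (simp add: vimage_def Int_def)
  then obtain T where T: "closed T" "{z \<in> param_domain. real k * rotation_number \<beta> z \<in> \<int>} = param_domain \<inter> T"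
    by (auto simp: closedin_closed)
  have "?Z \<subseteq> T" using on_Z T(2) by blast
  then have "closure ?Z \<subseteq> T" using T(1) by (rule closure_minimal)
  then show ?thesis using z T(2) by blast
qed

text \<open>An integer-valued continuous function is constant on the connected set \<open>branch \<rho> \<theta> j k\<close>.\<close>

lemma rotation_number_on_branch:
  assumes jk: "0 < j" "j < 2 * k" and z: "z \<in> branch \<rho> \<theta> j k"
  shows "z \<in> param_domain" "real k * rotation_number \<beta> z = real j"
proof -
  let ?D = "param_domain \<inter> closure ({(a, s) \<in> param_domain. bif_fun \<rho> \<theta> k a s = 0} - triv_branch)"
  let ?f = "\<lambda>z. real k * rotation_number \<beta> z"
  have k: "k > 0" using jk by simp
  have sub: "branch \<rho> \<theta> j k \<subseteq> ?D" unfolding branch_def by (rule connected_component_subset)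
  then show "z \<in> param_domain" using z by blast
  \<comment> \<open>A connected component of a point outside the set is empty, so the existence of z
    puts the base point into the set.\<close>
  have base: "(a_bif j k, 0) \<in> branch \<rho> \<theta> j k"
    using z unfolding branch_def mem_Collect_eq
    by (intro connected_component_refl) (drule connected_component_in, rule conjunct1)
  have "?f constant_on branch \<rho> \<theta> j k"
  proof (rule continuous_discrete_range_constant)
    show "connected (branch \<rho> \<theta> j k)" unfolding branch_def by (rule connected_connected_component)
    show "continuous_on (branch \<rho> \<theta> j k) ?f"
      using sub by (intro continuous_on_mult_left continuous_on_subset[OF continuous_on_rotation_number]) auto
    show "\<exists>e>0. \<forall>y. y \<in> branch \<rho> \<theta> j k \<and> ?f y \<noteq> ?f x \<longrightarrow> e \<le> norm (?f y - ?f x)"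
      if x: "x \<in> branch \<rho> \<theta> j k" for x
    \<comment> \<open>The gap 1 is the least distance between distinct integers.\<close>
    proof (intro exI[of _ 1] conjI allI impI)
      fix y assume y: "y \<in> branch \<rho> \<theta> j k \<and> ?f y \<noteq> ?f x"
      have "?f y - ?f x \<in> \<int>"
        using x y sub k by (intro Ints_diff rotation_number_integral_on_zeros) auto
      then show "1 \<le> norm (?f y - ?f x)" using y Ints_nonzero_abs_ge1 by fastforce
    qed simp
  qed
  then have "?f z = ?f (a_bif j k, 0)" using z base unfolding constant_on_def by metis
  \<comment> \<open>At s = 0 the geodesic starts at the Clifford radius, so x = 0 and
    \<open>a_bif_half_turn\<close> evaluates the constant.\<close>
  also have "start_height \<beta> (a_bif j k, 0) = 0"
  proof -
    have "\<beta> (a_bif j k) 0 = rho_of (a_bif j k) (pi / 4)"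
      using \<beta> a_bif_half_turn(1)[OF jk] by (simp add: admissible_beta_def rho0_def)
    then show ?thesis using a_bif_half_turn(1)[OF jk] by (simp add: start_height_def phi_of_rho_of)
  qed
  then have "?f (a_bif j k, 0) = real j"
    using a_bif_half_turn(2)[OF jk] by (simp add: rotation_number_def)
  finally show "?f z = real j" .
qed

end

theorem proposition3p10:
  fixes \<beta> :: "real \<Rightarrow> real \<Rightarrow> real"
    and \<rho> \<theta> :: "real \<Rightarrow> real \<Rightarrow> real \<Rightarrow> real"
    and j k :: nat
  assumes "admissible_beta \<beta>"
    and "geodesic_family \<beta> \<rho> \<theta>"
    and "0 < j" and "j < 2 * k" and "coprime j k"
  shows
    "(\<forall>(a, s) \<in> branch \<rho> \<theta> j k - triv_branch.
        closed_geodesic_on a (\<rho> a s) (\<theta> a s) (- ell \<theta> k a s) (ell \<theta> k a s) \<and>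
        card {t \<in> {- ell \<theta> k a s .. ell \<theta> k a s}. \<rho> a s t = rho0 a} = 2 * j \<and>
        winding_about_O (curve a (\<rho> a s) (\<theta> a s)) (- ell \<theta> k a s) (ell \<theta> k a s) = of_nat k \<and>
        finite {t \<in> {0 <..< ell \<theta> k a s}.
          curve a (\<rho> a s) (\<theta> a s) (- t) = curve a (\<rho> a s) (\<theta> a s) t \<and>
          curve a (\<rho> a s) (\<theta> a s) t \<in> diam0 a} \<and>
        card {t \<in> {0 <..< ell \<theta> k a s}.
          curve a (\<rho> a s) (\<theta> a s) (- t) = curve a (\<rho> a s) (\<theta> a s) t \<and>
          curve a (\<rho> a s) (\<theta> a s) t \<in> diam0 a} = k - 1)
     \<and> (\<forall>j' k' :: nat. 0 < j' \<and> j' < 2 * k' \<and> coprime j' k' \<and> (j, k) \<noteq> (j', k') \<longrightarrow>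
          branch \<rho> \<theta> j k \<inter> branch \<rho> \<theta> j' k' = {})"
proof (intro conjI ballI allI impI)
  note rn = rotation_number_on_branch[OF assms(1,2)]
  have k: "k > 0" using assms by simp
  fix z assume z: "z \<in> branch \<rho> \<theta> j k - triv_branch"
  obtain a s where as: "z = (a, s)" by fastforce
  have dom: "(a, s) \<in> param_domain" and num: "real k * rotation_number \<beta> (a, s) = real j"
    using rn[OF assms(3,4), of z] z as by auto
  have s: "s \<noteq> 0" using z dom as by (auto simp: param_domain_def triv_branch_def)
  have a: "a > 0" using dom by (auto simp: param_domain_def)
  interpret clifford_oscillation a "\<rho> a s" "\<theta> a s"
    by (rule oscillation(1)[OF assms(1,2) dom])
  interpret closed_clifford_oscillation a "\<rho> a s" "\<theta> a s" j k "ell \<theta> k a s"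
  proof
    have x0: "x 0 = start_height \<beta> (a, s)" by (rule oscillation(2)[OF assms(1,2) dom])
    show "x 0 \<noteq> 0" unfolding x0 by (rule start_height_nonzero[OF assms(1,2) dom s])
    show "real j * half_turn a (x 0) = real k * pi"
      using num half_turn_pos[OF a x_range, of 0] unfolding x0 rotation_number_def
      by (simp add: field_simps)
    show "\<theta> a s (ell \<theta> k a s) = real k * pi" by (rule ell_props[OF assms(1,2) dom k])
  qed (use assms k in auto)
  show "case z of (a, s) \<Rightarrow>
        closed_geodesic_on a (\<rho> a s) (\<theta> a s) (- ell \<theta> k a s) (ell \<theta> k a s) \<and>
        card {t \<in> {- ell \<theta> k a s .. ell \<theta> k a s}. \<rho> a s t = rho0 a} = 2 * j \<and>
        winding_about_O (curve a (\<rho> a s) (\<theta> a s)) (- ell \<theta> k a s) (ell \<theta> k a s) = of_nat k \<and>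
        finite {t \<in> {0 <..< ell \<theta> k a s}.
          curve a (\<rho> a s) (\<theta> a s) (- t) = curve a (\<rho> a s) (\<theta> a s) t \<and>
          curve a (\<rho> a s) (\<theta> a s) t \<in> diam0 a} \<and>
        card {t \<in> {0 <..< ell \<theta> k a s}.
          curve a (\<rho> a s) (\<theta> a s) (- t) = curve a (\<rho> a s) (\<theta> a s) t \<and>
          curve a (\<rho> a s) (\<theta> a s) t \<in> diam0 a} = k - 1"
    unfolding as prod.case
    by (intro conjI closed card_crossings winding finite_self_intersections card_self_intersections)
next
  fix j' k' :: nat
  assume jk': "0 < j' \<and> j' < 2 * k' \<and> coprime j' k' \<and> (j, k) \<noteq> (j', k')"
  show "branch \<rho> \<theta> j k \<inter> branch \<rho> \<theta> j' k' = {}"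
  proof (rule ccontr)
    assume "branch \<rho> \<theta> j k \<inter> branch \<rho> \<theta> j' k' \<noteq> {}"
    then obtain z where z: "z \<in> branch \<rho> \<theta> j k" "z \<in> branch \<rho> \<theta> j' k'" by blast
    \<comment> \<open>At a common point the rotation number is both j / k and j' / k'; fractions in
      lowest terms with equal values coincide.\<close>
    have "real k * rotation_number \<beta> z = real j" "real k' * rotation_number \<beta> z = real j'"
      using rotation_number_on_branch(2)[OF assms(1,2)] z assms jk' by auto
    then have "real k' * real j = real k * real j'" by (metis mult.left_commute)
    then have e: "k' * j = k * j'" by (metis of_nat_eq_iff of_nat_mult)
    then have "j = j' \<and> k' = k"
      using coprime_crossproduct_nat[of j k j' k'] assms(5) jk' by (simp add: mult.commute)
    then show False using jk' by simp
  qed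
qed

end
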